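(* Let $(\widehat M^{n+m},\hat g)=(\mathbb{R}^{n},\bar g)\times_f(N^{m},\tilde g)$, $n\geq 3$ and $m\geq 2$, be a warped product semi-Riemannian manifold such that $N$ is a Ricci-flat semi-Riemannian manifold. Let $(\mathbb{R}^{n},g)$ be a pseudo-Euclidean space with coordinates $x=(x_1,\ldots,x_n)$ and $g_{ij}=\delta_{ij}\varepsilon_i$, $1\leq i,j\leq n$, where $\delta_{ij}$ is the Kronecker delta and $\varepsilon_i=\pm1$, with at least one $\varepsilon_i=1$. Consider smooth functions $\varphi(\xi)$ and $f(\xi)$, with $\varphi$ nowhere zero and $f>0$, where $\xi=\sum_{k=1}^{n}\alpha_k x_k$, $\alpha_k\in\mathbb{R}$, and $\sum_{k=1}^{n}\varepsilon_k\alpha_k^{2}=\kappa$. Then $(\mathbb{R}^{n},\bar g)\times_f(N^{m},\tilde g)$, where $\bar g=\frac{1}{\varphi^{2}}g$, is an Einstein warped product semi-Riemannian manifold (i.e., $\widehat{Ric}=\lambda\hat g$) such that $f$ and $\varphi$ are given by $$\left\{\begin{array}{l}(n-2)\varphi\varphi''-m\left(G\varphi\right)'=mG^{2},\\ \varphi\varphi''-(n-1)(\varphi')^{2}+mG\varphi'=\kappa\lambda,\\ nG\varphi'-(G\varphi)'-mG^{2}=\kappa\lambda,\end{array}\right.$$ and $$f=\Theta\exp\left(\int\frac{G}{\varphi}\,d\xi\right),$$ where $\Theta\in\mathbb{R}_{+}\backslash\{0\}$, $G(\xi)=\pm\sqrt{\frac{\kappa[\lambda(n-m)-\bar R]}{m(m-1)}}$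 and $\kappa=\pm1$. Here $\bar R$ is the scalar curvature of $\bar g$.
   Context: The warped product $(M^{n},h)\times_f(N^{m},\tilde g)$ is the product manifold $M\times N$ endowed with the metric $\hat g=h+f^{2}\tilde g$, where $f:M\to(0,+\infty)$ is smooth; here the base is $(\mathbb{R}^{n},\bar g)$. $\widehat{Ric}$ is the Ricci tensor of $\hat g$, and $\lambda\in\mathbb{R}$ is a constant. The prime denotes the derivative with respect to $\xi$. *)

theory Defs
  imports "HOL-Analysis.Analysis"
begin

definition dir_deriv :: "'a::euclidean_space \<Rightarrow> ('a \<Rightarrow> real) \<Rightarrow> 'a \<Rightarrow> real" where
  "dir_deriv b F x = deriv (\<lambda>t. F (x + t *\<^sub>R b)) 0"

text \<open>Only meant for open \<open>S\<close>. On \<open>real\<close> the only basis vector is \<open>1\<close>, and \<open>dir_deriv 1\<close> is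
  \<open>deriv\<close>.\<close>

primrec C_k_on :: "nat \<Rightarrow> 'a::euclidean_space set \<Rightarrow> ('a \<Rightarrow> real) \<Rightarrow> bool" where
  "C_k_on 0 S F \<longleftrightarrow> continuous_on S F"
| "C_k_on (Suc k) S F \<longleftrightarrow>
     (\<forall>x\<in>S. F differentiable (at x)) \<and> (\<forall>b\<in>Basis. C_k_on k S (dir_deriv b F))"

definition smooth_on :: "'a::euclidean_space set \<Rightarrow> ('a \<Rightarrow> real) \<Rightarrow> bool" where
  "smooth_on S F \<longleftrightarrow> (\<forall>k. C_k_on k S F)"

definition partial_deriv :: "'n::finite \<Rightarrow> (real^'n \<Rightarrow> real) \<Rightarrow> real^'n \<Rightarrow> real" where
  "partial_deriv i F x = dir_deriv (axis i 1) F x"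


text \<open>A metric on an open subset of coordinate space is given by its matrix of components
  \<open>g y $ i $ j\<close>. The sign and index conventions are
  \<open>R\<^sup>l\<^sub>i\<^sub>k\<^sub>j = \<partial>\<^sub>k \<Gamma>\<^sup>l\<^sub>i\<^sub>j - \<partial>\<^sub>j \<Gamma>\<^sup>l\<^sub>i\<^sub>k + \<Gamma>\<^sup>l\<^sub>k\<^sub>a \<Gamma>\<^sup>a\<^sub>i\<^sub>j - \<Gamma>\<^sup>l\<^sub>j\<^sub>a \<Gamma>\<^sup>a\<^sub>i\<^sub>k\<close> and \<open>Ric\<^sub>i\<^sub>j = R\<^sup>k\<^sub>i\<^sub>k\<^sub>j\<close>,
  so that round spheres have positive Ricci curvature.\<close>

definition christoffel ::
    "(real^'n \<Rightarrow> real^'n^'n) \<Rightarrow> 'n::finite \<Rightarrow> 'n \<Rightarrow> 'n \<Rightarrow> real^'n \<Rightarrow> real" where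
  "christoffel g k i j y =
     (1/2) * (\<Sum>l\<in>UNIV. matrix_inv (g y) $ k $ l *
       (partial_deriv i (\<lambda>z. g z $ j $ l) y + partial_deriv j (\<lambda>z. g z $ i $ l) y
        - partial_deriv l (\<lambda>z. g z $ i $ j) y))"

definition riemann ::
    "(real^'n \<Rightarrow> real^'n^'n) \<Rightarrow> 'n::finite \<Rightarrow> 'n \<Rightarrow> 'n \<Rightarrow> 'n \<Rightarrow> real^'n \<Rightarrow> real" where
  "riemann g l i k j y =
     partial_deriv k (christoffel g l i j) y - partial_deriv j (christoffel g l i k) y
     + (\<Sum>a\<in>UNIV. christoffel g l k a y * christoffel g a i j y
                  - christoffel g l j a y * christoffel g a i k y)"

definition ricci ::
    "(real^'n \<Rightarrow> real^'n^'n) \<Rightarrow> 'n::finite \<Rightarrow> 'n \<Rightarrow> real^'n \<Rightarrow> real" where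
  "ricci g i j y = (\<Sum>k\<in>UNIV. riemann g k i k j y)"

definition scalar_curvature :: "(real^'n::finite \<Rightarrow> real^'n^'n) \<Rightarrow> real^'n \<Rightarrow> real" where
  "scalar_curvature g y =
     (\<Sum>i\<in>UNIV. \<Sum>j\<in>UNIV. matrix_inv (g y) $ i $ j * ricci g i j y)"


text \<open>The underlying space is a whole type \<open>'p\<close>; the atlas is a family of charts indexed by
  \<open>charts\<close>, and \<open>metric c\<close> gives the components of the metric tensor in the chart \<open>c\<close>, as a
  function of the coordinates. Values of \<open>coord c\<close> outside \<open>dom_of c\<close>, and of \<open>metric c\<close> outside
  the coordinate image, are irrelevant.\<close>

record ('p, 'c, 'm) metric_atlas =
  charts :: "'c set"
  dom_of :: "'c \<Rightarrow> 'p set"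
  coord  :: "'c \<Rightarrow> 'p \<Rightarrow> real^'m"
  metric :: "'c \<Rightarrow> real^'m \<Rightarrow> real^'m^'m"

definition image_of :: "('p, 'c, 'm::finite) metric_atlas \<Rightarrow> 'c \<Rightarrow> (real^'m) set" where
  "image_of M c = coord M c ` dom_of M c"

definition param :: "('p, 'c, 'm::finite) metric_atlas \<Rightarrow> 'c \<Rightarrow> real^'m \<Rightarrow> 'p" where
  "param M c = inv_into (dom_of M c) (coord M c)"

definition transition ::
    "('p, 'c, 'm::finite) metric_atlas \<Rightarrow> 'c \<Rightarrow> 'c \<Rightarrow> real^'m \<Rightarrow> real^'m" where
  "transition M c d y = coord M d (param M c y)"

definition jacobian_matrix :: "(real^'m \<Rightarrow> real^'m) \<Rightarrow> real^'m \<Rightarrow> real^'m^'m::finite" where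
  "jacobian_matrix F y = (\<chi> a b. partial_deriv b (\<lambda>z. F z $ a) y)"

definition smooth_manifold ::
    "('p::{t2_space,second_countable_topology}, 'c, 'm::finite) metric_atlas \<Rightarrow> bool" where
  "smooth_manifold M \<longleftrightarrow>
     (\<Union>c\<in>charts M. dom_of M c) = UNIV \<and>
     (\<forall>c\<in>charts M. open (dom_of M c) \<and> open (image_of M c) \<and>
        homeomorphism (dom_of M c) (image_of M c) (coord M c) (param M c)) \<and>
     (\<forall>c\<in>charts M. \<forall>d\<in>charts M. \<forall>a.
        smooth_on (coord M c ` (dom_of M c \<inter> dom_of M d)) (\<lambda>y. transition M c d y $ a))"

text \<open>Sylvester normal form: the symmetric matrix \<open>A\<close> has signature \<open>s\<close> (up to ordering).\<close>

definition has_signature :: "real^'m^'m \<Rightarrow> ('m::finite \<Rightarrow> real) \<Rightarrow> bool" where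
  "has_signature A s \<longleftrightarrow>
     (\<exists>P. invertible P \<and> transpose P ** A ** P = (\<chi> i j. if i = j then s i else 0))"

definition semi_riemannian_manifold ::
    "('p::{t2_space,second_countable_topology}, 'c, 'm::finite) metric_atlas \<Rightarrow> bool" where
  "semi_riemannian_manifold M \<longleftrightarrow>
     smooth_manifold M \<and>
     (\<forall>c\<in>charts M. \<forall>i j. smooth_on (image_of M c) (\<lambda>y. metric M c y $ i $ j)) \<and>
     (\<forall>c\<in>charts M. \<forall>y\<in>image_of M c.
        transpose (metric M c y) = metric M c y \<and> invertible (metric M c y)) \<and>
     (\<forall>c\<in>charts M. \<forall>d\<in>charts M. \<forall>y\<in>coord M c ` (dom_of M c \<inter> dom_of M d).
        metric M c y =
          transpose (jacobian_matrix (transition M c d) y) ** metric M d (transition M c d y)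
            ** jacobian_matrix (transition M c d) y) \<and>
     (\<exists>s. (\<forall>i. s i = 1 \<or> s i = -1) \<and>
        (\<forall>c\<in>charts M. \<forall>y\<in>image_of M c. has_signature (metric M c y) s))"

definition ricci_flat :: "('p, 'c, 'm::finite) metric_atlas \<Rightarrow> bool" where
  "ricci_flat M \<longleftrightarrow>
     (\<forall>c\<in>charts M. \<forall>y\<in>image_of M c. \<forall>i j. ricci (metric M c) i j y = 0)"

definition einstein_manifold ::
    "('p::{t2_space,second_countable_topology}, 'c, 'm::finite) metric_atlas \<Rightarrow> real \<Rightarrow> bool" where
  "einstein_manifold M lam \<longleftrightarrow>
     semi_riemannian_manifold M \<and>
     (\<forall>c\<in>charts M. \<forall>y\<in>image_of M c. \<forall>i j.
        ricci (metric M c) i j y = lam * metric M c y $ i $ j)"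


definition left_part :: "real^('n::finite + 'm::finite) \<Rightarrow> real^'n" where
  "left_part y = (\<chi> i. y $ Inl i)"

definition right_part :: "real^('n::finite + 'm::finite) \<Rightarrow> real^'m" where
  "right_part y = (\<chi> j. y $ Inr j)"

definition join_parts :: "real^'n::finite \<Rightarrow> real^'m::finite \<Rightarrow> real^('n + 'm)" where
  "join_parts u v = (\<chi> k. case k of Inl i \<Rightarrow> u $ i | Inr j \<Rightarrow> v $ j)"

definition block_diag ::
    "real^'n^'n \<Rightarrow> real^'m^'m \<Rightarrow> real^('n::finite + 'm::finite)^('n + 'm)" where
  "block_diag A B = (\<chi> k l. case k of
       Inl i \<Rightarrow> (case l of Inl i' \<Rightarrow> A $ i $ i' | Inr _ \<Rightarrow> 0)
     | Inr j \<Rightarrow> (case l of Inl _ \<Rightarrow> 0 | Inr j' \<Rightarrow> B $ j $ j'))"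

text \<open>The product manifold, with the atlas of product charts, and the metric \<open>h + f\<^sup>2 g\<close>
  (\<open>h\<close>, \<open>g\<close> pulled back along the projections), which is block diagonal in a product chart.\<close>

definition warped_product ::
    "('p, 'c, 'n::finite) metric_atlas \<Rightarrow> ('p \<Rightarrow> real) \<Rightarrow> ('q, 'd, 'm::finite) metric_atlas
      \<Rightarrow> ('p \<times> 'q, 'c \<times> 'd, 'n + 'm) metric_atlas" where
  "warped_product M f N = \<lparr>
     charts = charts M \<times> charts N,
     dom_of = (\<lambda>(c, d). dom_of M c \<times> dom_of N d),
     coord  = (\<lambda>(c, d) (p, q). join_parts (coord M c p) (coord N d q)),
     metric = (\<lambda>(c, d) y. block_diag (metric M c (left_part y))
                ((f (param M c (left_part y)))\<^sup>2 *\<^sub>R metric N d (right_part y))) \<rparr>"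

definition coordinate_space ::
    "(real^'n \<Rightarrow> real^'n^'n) \<Rightarrow> (real^'n, unit, 'n::finite) metric_atlas" where
  "coordinate_space g =
     \<lparr> charts = UNIV, dom_of = (\<lambda>_. UNIV), coord = (\<lambda>_ x. x), metric = (\<lambda>_. g) \<rparr>"


definition pseudo_euclidean :: "('n::finite \<Rightarrow> real) \<Rightarrow> real^'n^'n" where
  "pseudo_euclidean \<epsilon> = (\<chi> i j. if i = j then \<epsilon> i else 0)"

definition lin_form :: "('n::finite \<Rightarrow> real) \<Rightarrow> real^'n \<Rightarrow> real" where
  "lin_form \<alpha> x = (\<Sum>k\<in>UNIV. \<alpha> k * x $ k)"

definition conformal_metric ::
    "('n::finite \<Rightarrow> real) \<Rightarrow> (real^'n \<Rightarrow> real) \<Rightarrow> real^'n \<Rightarrow> real^'n^'n" where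
  "conformal_metric \<epsilon> \<phi> x = (1 / (\<phi> x)\<^sup>2) *\<^sub>R pseudo_euclidean \<epsilon>"

end

theory Submission
  imports Defs
begin


text \<open>Write \<open>n\<close> and \<open>m\<close> for the dimensions of base and fibre and \<open>F\<close> for the warping function. In a
  product chart the Christoffel symbols of \<open>h + F\<^sup>2 g\<close> are those of \<open>h\<close> and of \<open>g\<close>, together with
  \<open>\<Gamma>\<^sup>c\<^sub>i\<^sub>b = (\<partial>\<^sub>iF / F) \<delta>\<^sup>c\<^sub>b\<close> and \<open>\<Gamma>\<^sup>k\<^sub>a\<^sub>b = - F (grad F)\<^sup>k g\<^sub>a\<^sub>b\<close>; all others vanish. Each of them is a function
  of the base coordinates times a function of the fibre coordinates, so the curvature can be
  computed block by block. The result is (lemma \<open>ricci_W\<close>)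
  \<open>Ric\<^sub>i\<^sub>j = Ric(h)\<^sub>i\<^sub>j - (m/F) Hess(F)\<^sub>i\<^sub>j\<close>, \<open>Ric\<^sub>i\<^sub>a = 0\<close>, and
  \<open>Ric\<^sub>a\<^sub>b = Ric(g)\<^sub>a\<^sub>b - (F \<Delta>F + (m - 1) \<bar>grad F\<bar>\<^sup>2) g\<^sub>a\<^sub>b\<close>.

  For \<open>h = \<phi>(\<xi>)\<^sup>-\<^sup>2 \<epsilon>\<close> and \<open>F = f(\<xi>)\<close>, with \<open>\<xi>\<close> a linear form with coefficients \<open>\<alpha>\<close>, the base block of
  \<open>Ric - \<lambda> (metric)\<close> has the form \<open>A(\<xi>) \<alpha>\<^sub>i \<alpha>\<^sub>j + B(\<xi>) \<epsilon>\<^sub>i \<delta>\<^sub>i\<^sub>j\<close>. As \<open>\<alpha>\<close> is not zero and the base has dimension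
  at least 2, it vanishes exactly if \<open>A = B = 0\<close> (lemma \<open>coefficients_vanish\<close>). Over a Ricci-flat
  fibre the fibre block is a scalar function of \<open>\<xi>\<close> times the nonzero matrix \<open>g\<close>. Since \<open>\<xi>\<close> takes
  every real value, the Einstein condition is a system of three ordinary differential
  equations in \<open>\<phi>\<close> and \<open>f\<close> (lemma \<open>einstein_warped_product_iff\<close>).

  The formula \<open>f = \<Theta> exp (\<integral> G/\<phi>)\<close> says nothing but \<open>G = \<phi> f'/f\<close>. Substituting this \<open>G\<close> turns the three
  equations into the stated system (lemma \<open>einstein_equations_algebra\<close>); and eliminating
  \<open>\<phi>''\<close> and \<open>(G\<phi>)'\<close> from the system leaves \<open>m (m - 1) G\<^sup>2 = \<kappa> (\<lambda> (n - m) - R)\<close> with \<open>R\<close> the scalar curvature of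
  the base (lemma \<open>scalar_curvature_of_solution\<close>), which is the asserted form of \<open>G\<close>.\<close>

section \<open>Calculus of smooth functions\<close>

lemma dir_deriv_eqI:
  assumes "(F has_derivative D) (at x)"
  shows "dir_deriv b F x = D b"
proof -
  have "((\<lambda>t. F (x + t *\<^sub>R b)) has_derivative (\<lambda>t. D (t *\<^sub>R b))) (at (0::real))"
  proof (rule has_derivative_compose[where f="\<lambda>t. x + t *\<^sub>R b" and f'="\<lambda>t. t *\<^sub>R b" and g=F and g'=D, simplified])
    show "((\<lambda>t. x + t *\<^sub>R b) has_derivative (\<lambda>t. t *\<^sub>R b)) (at 0)"
      by (auto intro!: derivative_eq_intros)
  qed (use assms in simp)
  moreover have "(\<lambda>t. D (t *\<^sub>R b)) = (\<lambda>t. D b * t)"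
    using has_derivative_bounded_linear[OF assms] by (auto simp: linear_simps fun_eq_iff)
  ultimately have "((\<lambda>t. F (x + t *\<^sub>R b)) has_field_derivative D b) (at 0)"
    by (simp add: has_field_derivative_def mult.commute[of _ "D b"])
  then show ?thesis by (simp add: dir_deriv_def DERIV_imp_deriv)
qed

lemma dir_deriv_one: "dir_deriv 1 F x = deriv F x" for x :: real
proof -
  have "deriv F x = deriv (F \<circ> (\<lambda>t. x + t)) 0" by (rule deriv_shift_0)
  then show ?thesis by (simp add: dir_deriv_def o_def)
qed

lemma dir_deriv_cong:
  assumes "open S" "x \<in> S" "\<And>y. y \<in> S \<Longrightarrow> F y = G y"
  shows "dir_deriv b F x = dir_deriv b G x"
proof -
  have "open ((\<lambda>t. x + t *\<^sub>R b) -` S)"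
    by (rule open_vimage[OF assms(1)]) (intro continuous_intros)
  then have "eventually (\<lambda>t. t \<in> (\<lambda>t. x + t *\<^sub>R b) -` S) (nhds 0)"
    using assms(2) by (intro eventually_nhds_in_open) auto
  then have "eventually (\<lambda>t. F (x + t *\<^sub>R b) = G (x + t *\<^sub>R b)) (nhds 0)"
    by eventually_elim (use assms(3) in auto)
  then show ?thesis unfolding dir_deriv_def by (intro deriv_cong_ev) auto
qed

lemma dir_deriv_add:
  assumes "F differentiable (at x)" "G differentiable (at x)"
  shows "dir_deriv b (\<lambda>x. F x + G x) x = dir_deriv b F x + dir_deriv b G x"
proof -
  obtain D E where D: "(F has_derivative D) (at x)" "(G has_derivative E) (at x)"
    using assms by (auto simp: differentiable_def)
  show ?thesis
    using dir_deriv_eqI[OF has_derivative_add[OF D], of b] dir_deriv_eqI[OF D(1), of b]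
      dir_deriv_eqI[OF D(2), of b] by simp
qed

lemma dir_deriv_mult:
  assumes "F differentiable (at x)" "G differentiable (at x)"
  shows "dir_deriv b (\<lambda>x. F x * G x) x = F x * dir_deriv b G x + dir_deriv b F x * G x"
proof -
  obtain D E where D: "(F has_derivative D) (at x)" "(G has_derivative E) (at x)"
    using assms by (auto simp: differentiable_def)
  show ?thesis
    using dir_deriv_eqI[OF has_derivative_mult[OF D], of b] dir_deriv_eqI[OF D(1), of b]
      dir_deriv_eqI[OF D(2), of b] by simp
qed

lemma dir_deriv_inverse:
  assumes "F differentiable (at x)" "F x \<noteq> 0"
  shows "dir_deriv b (\<lambda>x. inverse (F x)) x = - dir_deriv b F x * (inverse (F x) * inverse (F x))"
proof -
  obtain D where D: "(F has_derivative D) (at x)" using assms by (auto simp: differentiable_def)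
  show ?thesis
    by (subst dir_deriv_eqI[OF Deriv.has_derivative_inverse[OF assms(2) D]])
      (simp add: dir_deriv_eqI[OF D])
qed

lemma dir_deriv_const [simp]: "dir_deriv b (\<lambda>x. c) x = 0"
  by (simp add: dir_deriv_def)

lemma dir_deriv_compose_linear:
  assumes "linear L" "L b = c *\<^sub>R b'" "F differentiable (at (L x))"
  shows "dir_deriv b (\<lambda>x. F (L x)) x = c * dir_deriv b' F (L x)"
proof -
  obtain D where D: "(F has_derivative D) (at (L x))" using assms by (auto simp: differentiable_def)
  have "(L has_derivative L) (at x)"
    using assms(1) by (simp add: bounded_linear_imp_has_derivative linear_conv_bounded_linear)
  then have "((\<lambda>x. F (L x)) has_derivative (\<lambda>v. D (L v))) (at x)"
    using has_derivative_compose D by blast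
  from dir_deriv_eqI[OF this, of b] dir_deriv_eqI[OF D, of b'] show ?thesis
    using linear_scale[OF has_derivative_linear[OF D]] assms(2) by simp
qed

lemma differentiable_compose_linear:
  fixes L :: "'a::euclidean_space \<Rightarrow> 'b::real_normed_vector"
  assumes "linear L" "F differentiable (at (L x))"
  shows "(\<lambda>x. F (L x)) differentiable (at x)"
proof -
  have "(L has_derivative L) (at x)"
    using assms(1) by (simp add: bounded_linear_imp_has_derivative linear_conv_bounded_linear)
  then show ?thesis
    using has_derivative_compose assms(2) unfolding differentiable_def by blast
qed

text \<open>Openness matters: \<open>dir_deriv\<close> at a point of \<open>S\<close> sees the function on a whole neighbourhood, which
  must lie inside the set on which the two functions agree.\<close>
lemma C_k_on_cong:
  assumes "open S" "\<And>y. y \<in> S \<Longrightarrow> F y = G y" "C_k_on k S F"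
  shows "C_k_on k S G"
  using assms(2,3)
proof (induction k arbitrary: F G)
  case 0
  then show ?case using continuous_on_cong by (metis C_k_on.simps(1))
next
  case (Suc k)
  have "G differentiable (at x)" if "x \<in> S" for x
    using Suc.prems that assms(1)
    by (metis C_k_on.simps(2) differentiable_def has_derivative_transform_within_open)
  moreover have "C_k_on k S (dir_deriv b G)" if "b \<in> Basis" for b
  proof (rule Suc.IH)
    show "dir_deriv b F y = dir_deriv b G y" if "y \<in> S" for y
      by (rule dir_deriv_cong[OF assms(1) that Suc.prems(1)])
  qed (use Suc.prems that in auto)
  ultimately show ?case by auto
qed

lemma C_k_on_Suc_imp: "C_k_on (Suc k) S F \<Longrightarrow> C_k_on k S F"
proof (induction k arbitrary: F)
  case 0
  then show ?case
    by (auto intro!: continuous_at_imp_continuous_on differentiable_imp_continuous_within)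
next
  case (Suc k)
  then show ?case by (metis C_k_on.simps(2))
qed

lemma C_k_on_const: "C_k_on k S (\<lambda>x. c)"
proof (induction k arbitrary: c)
  case (Suc k)
  have "dir_deriv b (\<lambda>x. c) = (\<lambda>x. 0)" for b :: 'a by (auto simp: fun_eq_iff)
  then show ?case using Suc by auto
qed auto

lemma C_k_on_add:
  assumes "open S"
  shows "C_k_on k S F \<Longrightarrow> C_k_on k S G \<Longrightarrow> C_k_on k S (\<lambda>x. F x + G x)"
proof (induction k arbitrary: F G)
  case (Suc k)
  have "C_k_on k S (dir_deriv b (\<lambda>x. F x + G x))" if "b \<in> Basis" for b
    by (rule C_k_on_cong[OF assms _ Suc.IH[of "dir_deriv b F" "dir_deriv b G"]])
      (use Suc.prems that in \<open>auto simp: dir_deriv_add\<close>)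
  with Suc.prems show ?case by auto
qed (auto intro: continuous_on_add)

lemma C_k_on_mult:
  assumes "open S"
  shows "C_k_on k S F \<Longrightarrow> C_k_on k S G \<Longrightarrow> C_k_on k S (\<lambda>x. F x * G x)"
proof (induction k arbitrary: F G)
  case (Suc k)
  have "C_k_on k S (dir_deriv b (\<lambda>x. F x * G x))" if "b \<in> Basis" for b
    by (rule C_k_on_cong[OF assms _ C_k_on_add[OF assms Suc.IH[of F "dir_deriv b G"] Suc.IH[of "dir_deriv b F" G]]])
      (use Suc.prems that C_k_on_Suc_imp in \<open>auto simp: dir_deriv_mult\<close>)
  with Suc.prems show ?case by auto
qed (auto intro: continuous_on_mult)

lemma C_k_on_inverse:
  assumes "open S" "\<And>x. x \<in> S \<Longrightarrow> F x \<noteq> 0"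
  shows "C_k_on k S F \<Longrightarrow> C_k_on k S (\<lambda>x. inverse (F x))"
proof (induction k)
  case (Suc k)
  have I: "C_k_on k S (\<lambda>x. inverse (F x))" using Suc C_k_on_Suc_imp by blast
  have "C_k_on k S (dir_deriv b (\<lambda>x. inverse (F x)))" if "b \<in> Basis" for b
    by (rule C_k_on_cong[OF assms(1) _ C_k_on_mult[OF assms(1)
          C_k_on_mult[OF assms(1) C_k_on_const[of k S "-1"], of "dir_deriv b F"]
          C_k_on_mult[OF assms(1) I I]]])
      (use Suc.prems that assms in \<open>auto simp: dir_deriv_inverse\<close>)
  with Suc.prems assms show ?case by (auto intro: differentiable_inverse)
qed (use assms in \<open>auto intro: continuous_on_inverse\<close>)

text \<open>The hypothesis on \<open>L\<close> makes each derivative of \<open>F \<circ> L\<close> along a basis vector a single derivative of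
  \<open>F\<close> along a basis vector, composed with \<open>L\<close> and scaled; so the induction stays within functions of
  this shape. Coordinate projections and linear forms satisfy it.\<close>
lemma C_k_on_compose_linear:
  assumes "linear L" "\<forall>b\<in>Basis. \<exists>c. \<exists>b'\<in>Basis. L b = c *\<^sub>R b'" "open S"
  shows "C_k_on k S F \<Longrightarrow> C_k_on k (L -` S) (\<lambda>x. F (L x))"
proof (induction k arbitrary: F)
  case 0
  have "continuous_on (L -` S) L" using assms(1) by (simp add: linear_continuous_on linear_conv_bounded_linear)
  then show ?case using 0 continuous_on_compose2[of S F "L -` S" L] by auto
next
  case (Suc k)
  have op: "open (L -` S)"
    using assms(1,3) by (intro open_vimage) (simp_all add: linear_continuous_on linear_conv_bounded_linear)
  have "C_k_on k (L -` S) (dir_deriv b (\<lambda>x. F (L x)))" if b: "b \<in> Basis" for b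
  proof -
    obtain c b' where b': "b' \<in> Basis" "L b = c *\<^sub>R b'" using assms(2) b by blast
    show ?thesis
      by (rule C_k_on_cong[OF op _ C_k_on_mult[OF op C_k_on_const[of _ _ c] Suc.IH[of "dir_deriv b' F"]]])
        (use Suc.prems b' assms(1) in \<open>auto simp: dir_deriv_compose_linear\<close>)
  qed
  with Suc.prems assms(1) show ?case by (auto intro: differentiable_compose_linear)
qed

lemma smooth_on_const: "smooth_on S (\<lambda>x. c)" by (simp add: smooth_on_def C_k_on_const)

lemma smooth_on_cong:
  "open S \<Longrightarrow> (\<And>y. y \<in> S \<Longrightarrow> F y = G y) \<Longrightarrow> smooth_on S F \<Longrightarrow> smooth_on S G"
  unfolding smooth_on_def using C_k_on_cong by blast

lemma smooth_on_mult:
  "open S \<Longrightarrow> smooth_on S F \<Longrightarrow> smooth_on S G \<Longrightarrow> smooth_on S (\<lambda>x. F x * G x)"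
  by (simp add: smooth_on_def C_k_on_mult)

lemma smooth_on_divide:
  "open S \<Longrightarrow> smooth_on S F \<Longrightarrow> smooth_on S G \<Longrightarrow> (\<And>x. x \<in> S \<Longrightarrow> G x \<noteq> 0) \<Longrightarrow>
    smooth_on S (\<lambda>x. F x / G x)"
  by (simp add: smooth_on_def C_k_on_mult C_k_on_inverse divide_inverse)

lemma smooth_on_compose_linear:
  "linear L \<Longrightarrow> \<forall>b\<in>Basis. \<exists>c. \<exists>b'\<in>Basis. L b = c *\<^sub>R b' \<Longrightarrow> open S \<Longrightarrow> smooth_on S F \<Longrightarrow>
    smooth_on (L -` S) (\<lambda>x. F (L x))"
  by (simp add: smooth_on_def C_k_on_compose_linear)

lemma smooth_on_dir_deriv: "smooth_on S F \<Longrightarrow> b \<in> Basis \<Longrightarrow> smooth_on S (dir_deriv b F)"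
  unfolding smooth_on_def by (metis C_k_on.simps(2))

lemma smooth_on_differentiable: "smooth_on S F \<Longrightarrow> x \<in> S \<Longrightarrow> F differentiable (at x)"
  unfolding smooth_on_def by (metis C_k_on.simps(2))

lemma smooth_on_deriv:
  fixes u :: "real \<Rightarrow> real"
  assumes "smooth_on S u" shows "smooth_on S (deriv u)"
proof -
  have "dir_deriv 1 u = deriv u" by (auto simp: dir_deriv_one)
  with smooth_on_dir_deriv[OF assms, of 1] show ?thesis by simp
qed

lemma smooth_on_DERIV:
  fixes u :: "real \<Rightarrow> real"
  assumes "smooth_on S u" "x \<in> S" shows "(u has_real_derivative deriv u x) (at x)"
  using smooth_on_differentiable[OF assms]
  by (metis DERIV_imp_deriv real_differentiableE)

lemma smooth_on_linear:
  assumes "linear (L :: 'a::euclidean_space \<Rightarrow> real)"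
  shows "smooth_on S L"
  unfolding smooth_on_def
proof
  fix k
  have D: "(L has_derivative L) (at x)" for x
    using assms by (simp add: bounded_linear_imp_has_derivative linear_conv_bounded_linear)
  have "dir_deriv b L = (\<lambda>x. L b)" for b by (auto simp: dir_deriv_eqI[OF D])
  then show "C_k_on k S L"
    using D assms
    by (cases k) (auto simp: C_k_on_const differentiable_def linear_continuous_on linear_conv_bounded_linear)
qed

lemma smooth_on_subset: "smooth_on T F \<Longrightarrow> S \<subseteq> T \<Longrightarrow> smooth_on S F"
proof -
  have "C_k_on k T F \<Longrightarrow> S \<subseteq> T \<Longrightarrow> C_k_on k S F" for k
    by (induction k arbitrary: F) (auto intro: continuous_on_subset)
  then show "smooth_on T F \<Longrightarrow> S \<subseteq> T \<Longrightarrow> smooth_on S F" by (auto simp: smooth_on_def)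
qed

section \<open>Product coordinates and block matrices\<close>

lemma sum_UNIV_Plus:
  "(\<Sum>k\<in>(UNIV :: ('n::finite + 'm::finite) set). F k) = (\<Sum>i\<in>UNIV. F (Inl i)) + (\<Sum>j\<in>UNIV. F (Inr j))"
  by (simp only: UNIV_Plus_UNIV[symmetric] sum.Plus[OF finite finite] comp_def)

lemma sum_delta_mult:
  fixes X :: "'n::finite \<Rightarrow> real"
  shows "(\<Sum>d\<in>UNIV. X d * (if b = d then c d else 0)) = X b * c b"
  "(\<Sum>d\<in>UNIV. X d * (if d = b then c d else 0)) = X b * c b"
  "(\<Sum>d\<in>UNIV. (if b = d then c d else 0) * X d) = c b * X b"
  "(\<Sum>d\<in>UNIV. (if d = b then c d else 0) * X d) = c b * X b"
  by (simp_all add: if_distrib[where f="\<lambda>t. _ * t"] if_distrib[where f="\<lambda>t. t * _"] cong: if_cong)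

lemma left_part_nth [simp]: "left_part y $ i = y $ Inl i" by (simp add: left_part_def)
lemma right_part_nth [simp]: "right_part y $ j = y $ Inr j" by (simp add: right_part_def)
lemma join_parts_nth [simp]: "join_parts u v $ Inl i = u $ i" "join_parts u v $ Inr j = v $ j"
  by (simp_all add: join_parts_def)
lemma block_diag_nth [simp]:
  "block_diag A B $ Inl i $ Inl i' = A $ i $ i'" "block_diag A B $ Inl i $ Inr j = 0"
  "block_diag A B $ Inr j $ Inl i = 0" "block_diag A B $ Inr j $ Inr j' = B $ j $ j'"
  by (simp_all add: block_diag_def)

lemma vec_Plus_eqI:
  fixes u v :: "'a ^ ('n::finite + 'm::finite)"
  assumes "\<And>i. u $ Inl i = v $ Inl i" "\<And>j. u $ Inr j = v $ Inr j"
  shows "u = v"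
  unfolding vec_eq_iff using assms by (metis sum.exhaust)

lemma left_join [simp]: "left_part (join_parts u v) = u" by (simp add: vec_eq_iff)
lemma right_join [simp]: "right_part (join_parts u v) = v" by (simp add: vec_eq_iff)
lemma join_left_right [simp]: "join_parts (left_part y) (right_part y) = y"
  by (rule vec_Plus_eqI) auto

lemma linear_left_part: "linear left_part" by (rule linearI) (auto simp: vec_eq_iff)
lemma linear_right_part: "linear right_part" by (rule linearI) (auto simp: vec_eq_iff)

lemma parts_axis:
  "left_part (axis (Inl i) c) = axis i c" "left_part (axis (Inr j) c) = 0"
  "right_part (axis (Inl i) c) = 0" "right_part (axis (Inr j) c) = axis j c"
  by (auto simp: vec_eq_iff axis_def)

lemma open_right_part: "open U \<Longrightarrow> open (right_part -` U)"
  by (intro open_vimage linear_continuous_on linear_conv_bounded_linear[THEN iffD1] linear_right_part)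

lemma block_diag_mult:
  "block_diag A B ** block_diag C D = block_diag (A ** C) (B ** D)"
  by (intro vec_Plus_eqI) (auto simp: matrix_matrix_mult_def sum_UNIV_Plus)

lemma transpose_block_diag: "transpose (block_diag A B) = block_diag (transpose A) (transpose B)"
  by (intro vec_Plus_eqI) (auto simp: transpose_def)

lemma mat_1_block_diag: "mat 1 = block_diag (mat 1) (mat 1)"
  by (intro vec_Plus_eqI) (auto simp: mat_def)

lemma matrix_inv_mult:
  assumes "invertible A"
  shows "A ** matrix_inv A = mat 1" "matrix_inv A ** A = mat 1"
  using someI_ex[OF assms[unfolded invertible_def]] by (simp_all add: matrix_inv_def)

lemma matrix_inv_eqI:
  fixes A :: "real^'n^'n"
  assumes "A ** B = mat 1" "B ** A = mat 1"
  shows "matrix_inv A = B"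
proof -
  have "invertible A" using assms by (auto simp: invertible_def)
  then have "matrix_inv A ** (A ** B) = B"
    by (simp only: matrix_mul_assoc matrix_inv_mult matrix_mul_lid)
  then show ?thesis by (simp add: assms)
qed

lemma invertible_block_diag:
  assumes "invertible A" "invertible B"
  shows "invertible (block_diag A B)"
  using assms unfolding invertible_def by (metis block_diag_mult mat_1_block_diag)

lemma matrix_inv_block_diag:
  assumes "invertible A" "invertible B"
  shows "matrix_inv (block_diag A B) = block_diag (matrix_inv A) (matrix_inv B)"
  using assms by (intro matrix_inv_eqI)
    (simp_all add: block_diag_mult matrix_inv_mult mat_1_block_diag)

lemma matrix_inv_scaleR:
  fixes A :: "real^'n^'n"
  assumes "invertible A" "c \<noteq> 0"
  shows "matrix_inv (c *\<^sub>R A) = (1 / c) *\<^sub>R matrix_inv A"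
  using assms by (intro matrix_inv_eqI)
    (simp_all add: matrix_inv_mult matrix_scalar_ac scalar_matrix_assoc[symmetric])

lemma exists_nonzero_entry:
  fixes A :: "real^'k::finite^'k"
  assumes "invertible A"
  obtains a b where "A $ a $ b \<noteq> 0"
proof -
  have "A \<noteq> 0"
  proof
    assume "A = 0"
    then have "(mat 1 :: real^'k^'k) = 0"
      using matrix_inv_mult(1)[OF assms] by (simp add: matrix_matrix_mult_def vec_eq_iff zero_vec_def)
    then have "(mat 1 :: real^'k^'k) $ undefined $ undefined = 0" by simp
    then show False by (simp add: mat_def)
  qed
  then show thesis using that by (metis vec_eq_iff zero_index)
qed

text \<open>Moving along a base direction leaves the fibre coordinates alone and conversely, so both sides
  are derivatives of the same function of one real variable.\<close>
lemma partial_deriv_parts: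
  "partial_deriv (Inl i) (\<lambda>y. F (left_part y) (right_part y)) y
    = partial_deriv i (\<lambda>x. F x (right_part y)) (left_part y)"
  "partial_deriv (Inr j) (\<lambda>y. F (left_part y) (right_part y)) y
    = partial_deriv j (\<lambda>z. F (left_part y) z) (right_part y)"
  by (simp_all add: partial_deriv_def dir_deriv_def parts_axis
      linear_add[OF linear_left_part] linear_add[OF linear_right_part]
      linear_scale[OF linear_left_part] linear_scale[OF linear_right_part])

lemma Basis_vec_cases:
  assumes "b \<in> (Basis :: (real^'k::finite) set)"
  obtains k where "b = axis k 1"
  using assms by (auto simp: Basis_vec_def)

text \<open>The projections send each coordinate vector to a coordinate vector or to zero; a vanishing
  image is written as zero times an arbitrary basis vector.\<close>
lemma smooth_on_compose_left_part:
  assumes "smooth_on UNIV (F :: real^'n::finite \<Rightarrow> real)"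
  shows "smooth_on (UNIV :: (real^('n + 'm::finite)) set) (\<lambda>y. F (left_part y))"
proof -
  have "\<forall>b\<in>(Basis :: (real^('n + 'm)) set). \<exists>c. \<exists>b'\<in>Basis. (left_part b :: real^'n) = c *\<^sub>R b'"
  proof
    fix b :: "real^('n + 'm)" assume "b \<in> Basis"
    then obtain k where k: "b = axis k 1" by (rule Basis_vec_cases)
    show "\<exists>c. \<exists>b'\<in>Basis. (left_part b :: real^'n) = c *\<^sub>R b'"
    proof (cases k)
      case (Inl i)
      then have "left_part b = 1 *\<^sub>R axis i 1" by (simp add: k parts_axis)
      then show ?thesis by (metis axis_in_Basis_iff Basis_real_def insertI1)
    next
      case (Inr j)
      then have "left_part b = 0 *\<^sub>R axis undefined 1" by (simp add: k parts_axis)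
      then show ?thesis by (metis axis_in_Basis_iff Basis_real_def insertI1)
    qed
  qed
  from smooth_on_compose_linear[OF linear_left_part this open_UNIV assms] show ?thesis by simp
qed

lemma smooth_on_compose_right_part:
  assumes "smooth_on U (F :: real^'m::finite \<Rightarrow> real)" "open U"
  shows "smooth_on (right_part -` U :: (real^('n::finite + 'm)) set) (\<lambda>y. F (right_part y))"
proof -
  have "\<forall>b\<in>(Basis :: (real^('n + 'm)) set). \<exists>c. \<exists>b'\<in>Basis. (right_part b :: real^'m) = c *\<^sub>R b'"
  proof
    fix b :: "real^('n + 'm)" assume "b \<in> Basis"
    then obtain k where k: "b = axis k 1" by (rule Basis_vec_cases)
    show "\<exists>c. \<exists>b'\<in>Basis. (right_part b :: real^'m) = c *\<^sub>R b'"
    proof (cases k)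
      case (Inr j)
      then have "right_part b = 1 *\<^sub>R axis j 1" by (simp add: k parts_axis)
      then show ?thesis by (metis axis_in_Basis_iff Basis_real_def insertI1)
    next
      case (Inl i)
      then have "right_part b = 0 *\<^sub>R axis undefined 1" by (simp add: k parts_axis)
      then show ?thesis by (metis axis_in_Basis_iff Basis_real_def insertI1)
    qed
  qed
  from smooth_on_compose_linear[OF linear_right_part this assms(2,1)] show ?thesis .
qed

lemma partial_deriv_const [simp]: "partial_deriv i (\<lambda>x. c) x = 0"
  by (simp add: partial_deriv_def)

lemma partial_deriv_cong:
  "open S \<Longrightarrow> x \<in> S \<Longrightarrow> (\<And>y. y \<in> S \<Longrightarrow> F y = G y) \<Longrightarrow> partial_deriv i F x = partial_deriv i G x"
  unfolding partial_deriv_def by (rule dir_deriv_cong)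

lemma partial_deriv_mult:
  assumes "F differentiable (at x)" "G differentiable (at x)"
  shows "partial_deriv i (\<lambda>x. F x * G x) x = F x * partial_deriv i G x + partial_deriv i F x * G x"
  using assms by (simp add: partial_deriv_def dir_deriv_mult)

lemma partial_deriv_cmult:
  assumes "F differentiable (at x)"
  shows "partial_deriv i (\<lambda>x. F x * c) x = partial_deriv i F x * c"
    "partial_deriv i (\<lambda>x. c * F x) x = c * partial_deriv i F x"
  using assms by (simp_all add: partial_deriv_mult)

lemma partial_deriv_divide:
  assumes "F differentiable (at x)" "G differentiable (at x)" "G x \<noteq> 0"
  shows "partial_deriv i (\<lambda>x. F x / G x) x
    = partial_deriv i F x / G x - F x * partial_deriv i G x / (G x)\<^sup>2"
  using assms by (simp add: divide_inverse partial_deriv_def dir_deriv_mult dir_deriv_inverse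
      differentiable_inverse power2_eq_square)

lemma partial_deriv_nth:
  fixes x :: "real^'n::finite"
  shows "partial_deriv j (\<lambda>x. x $ i) x = (if i = j then 1 else 0)"
proof -
  have "((\<lambda>x. x $ i) has_derivative (\<lambda>x. x $ i)) (at x)"
    by (rule bounded_linear_imp_has_derivative) (rule bounded_linear_vec_nth)
  then show ?thesis by (simp add: partial_deriv_def dir_deriv_eqI axis_def)
qed

lemma transpose_nth_eq: "transpose A = A \<Longrightarrow> A $ i $ j = A $ j $ i"
  by (auto simp: transpose_def vec_eq_iff)

lemma christoffel_symmetric:
  assumes "open S" "y \<in> S" "\<And>z. z \<in> S \<Longrightarrow> transpose (g z) = g z"
  shows "christoffel g k i j y = christoffel g k j i y"
proof -
  have "partial_deriv l (\<lambda>z. g z $ i $ j) y = partial_deriv l (\<lambda>z. g z $ j $ i) y" for l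
    by (rule partial_deriv_cong[OF assms(1,2)]) (rule transpose_nth_eq[OF assms(3)])
  then show ?thesis unfolding christoffel_def by (metis (no_types, lifting) add.commute)
qed

section \<open>Ricci curvature of a warped product in a product chart\<close>

definition gradient :: "(real^'n \<Rightarrow> real^'n^'n) \<Rightarrow> (real^'n \<Rightarrow> real) \<Rightarrow> 'n::finite \<Rightarrow> real^'n \<Rightarrow> real" where
  "gradient g F k x = (\<Sum>l\<in>UNIV. matrix_inv (g x) $ k $ l * partial_deriv l F x)"

definition hessian :: "(real^'n \<Rightarrow> real^'n^'n) \<Rightarrow> (real^'n \<Rightarrow> real) \<Rightarrow> 'n::finite \<Rightarrow> 'n \<Rightarrow> real^'n \<Rightarrow> real" where
  "hessian g F i j x = partial_deriv j (partial_deriv i F) x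
     - (\<Sum>l\<in>UNIV. christoffel g l i j x * partial_deriv l F x)"

text \<open>The divergence of the gradient, with the divergence taken by means of the Levi-Civita
  connection. Keeping the Christoffel symbols here, instead of the density \<open>sqrt \<bar>det g\<bar>\<close>, is what
  lets the trace of the curvature be read off without an identity for the derivative of a
  determinant.\<close>
definition laplacian :: "(real^'n::finite \<Rightarrow> real^'n^'n) \<Rightarrow> (real^'n \<Rightarrow> real) \<Rightarrow> real^'n \<Rightarrow> real" where
  "laplacian g F x = (\<Sum>k\<in>UNIV. partial_deriv k (gradient g F k) x
     + (\<Sum>l\<in>UNIV. christoffel g k k l x * gradient g F l x))"

definition grad_norm_sq :: "(real^'n::finite \<Rightarrow> real^'n^'n) \<Rightarrow> (real^'n \<Rightarrow> real) \<Rightarrow> real^'n \<Rightarrow> real" where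
  "grad_norm_sq g F x = (\<Sum>k\<in>UNIV. gradient g F k x * partial_deriv k F x)"

definition warped_metric :: "(real^'n \<Rightarrow> real^'n^'n) \<Rightarrow> (real^'n \<Rightarrow> real) \<Rightarrow> (real^'m \<Rightarrow> real^'m^'m)
    \<Rightarrow> real^('n::finite + 'm::finite) \<Rightarrow> real^('n + 'm)^('n + 'm)" where
  "warped_metric h F g y = block_diag (h (left_part y)) ((F (left_part y))\<^sup>2 *\<^sub>R g (right_part y))"

text \<open>Local data of a warped product over the whole coordinate space, with fibre chart domain \<open>U\<close>.
  The assumptions on \<open>dF\<close> and on the gradient are what differentiating the Christoffel symbols
  \<open>\<partial>\<^sub>iF / F\<close> and \<open>- F (grad F)\<^sup>k g\<^sub>a\<^sub>b\<close> once more takes.\<close>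
locale warped_chart =
  fixes h :: "real^'n::finite \<Rightarrow> real^'n^'n" and F :: "real^'n \<Rightarrow> real"
    and g :: "real^'m::finite \<Rightarrow> real^'m^'m" and U :: "(real^'m) set"
  assumes open_U: "open U"
    and h_sym: "transpose (h x) = h x" and h_inv: "invertible (h x)"
    and g_sym: "z \<in> U \<Longrightarrow> transpose (g z) = g z" and g_inv: "z \<in> U \<Longrightarrow> invertible (g z)"
    and g_diff: "z \<in> U \<Longrightarrow> (\<lambda>z. g z $ a $ b) differentiable (at z)"
    and F_nz: "F x \<noteq> 0" and F_diff: "F differentiable (at x)"
    and dF_diff: "partial_deriv i F differentiable (at x)"
    and grad_diff: "gradient h F k differentiable (at x)"
begin

abbreviation "W \<equiv> warped_metric h F g"

lemma W_nth:
  "W y $ Inl i $ Inl j = h (left_part y) $ i $ j" "W y $ Inl i $ Inr b = 0" "W y $ Inr b $ Inl i = 0"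
  "W y $ Inr a $ Inr b = (F (left_part y))\<^sup>2 * g (right_part y) $ a $ b"
  by (simp_all add: warped_metric_def)

lemma inv_W:
  assumes "right_part y \<in> U"
  shows "matrix_inv (W y) = block_diag (matrix_inv (h (left_part y)))
    ((1 / (F (left_part y))\<^sup>2) *\<^sub>R matrix_inv (g (right_part y)))"
proof -
  have "invertible ((F (left_part y))\<^sup>2 *\<^sub>R g (right_part y))"
    using g_inv[OF assms] F_nz by (simp add: scalar_invertible)
  then show ?thesis
    using g_inv[OF assms] F_nz h_inv by (simp add: warped_metric_def matrix_inv_block_diag matrix_inv_scaleR)
qed

lemma partial_deriv_W:
  assumes "right_part y \<in> U"
  shows "partial_deriv (Inl k) (\<lambda>y. W y $ Inl i $ Inl j) y = partial_deriv k (\<lambda>x. h x $ i $ j) (left_part y)"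
    "partial_deriv (Inr c) (\<lambda>y. W y $ Inl i $ Inl j) y = 0"
    "partial_deriv K (\<lambda>y. W y $ Inl i $ Inr b) y = 0"
    "partial_deriv K (\<lambda>y. W y $ Inr b $ Inl i) y = 0"
    "partial_deriv (Inl k) (\<lambda>y. W y $ Inr a $ Inr b) y
      = 2 * F (left_part y) * partial_deriv k F (left_part y) * g (right_part y) $ a $ b"
    "partial_deriv (Inr c) (\<lambda>y. W y $ Inr a $ Inr b) y
      = (F (left_part y))\<^sup>2 * partial_deriv c (\<lambda>z. g z $ a $ b) (right_part y)"
proof -
  have d: "(\<lambda>x. (F x)\<^sup>2) differentiable (at x)" for x
    unfolding power2_eq_square using F_diff by (intro differentiable_mult)
  have e: "partial_deriv k (\<lambda>x. (F x)\<^sup>2) x = 2 * F x * partial_deriv k F x" for x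
    unfolding power2_eq_square using F_diff by (simp add: partial_deriv_mult)
  show "partial_deriv (Inl k) (\<lambda>y. W y $ Inl i $ Inl j) y = partial_deriv k (\<lambda>x. h x $ i $ j) (left_part y)"
    "partial_deriv (Inr c) (\<lambda>y. W y $ Inl i $ Inl j) y = 0"
    unfolding W_nth
    using partial_deriv_parts[of _ "\<lambda>x z. h x $ i $ j"] by simp_all
  show "partial_deriv (Inl k) (\<lambda>y. W y $ Inr a $ Inr b) y
      = 2 * F (left_part y) * partial_deriv k F (left_part y) * g (right_part y) $ a $ b"
    "partial_deriv (Inr c) (\<lambda>y. W y $ Inr a $ Inr b) y
      = (F (left_part y))\<^sup>2 * partial_deriv c (\<lambda>z. g z $ a $ b) (right_part y)"
    unfolding W_nth
    using partial_deriv_parts[of _ "\<lambda>x z. (F x)\<^sup>2 * g z $ a $ b"] d g_diff[OF assms]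
    by (simp_all add: partial_deriv_cmult e)
qed (simp_all add: W_nth)

lemma W_symmetric:
  assumes "right_part y \<in> U" shows "transpose (W y) = W y"
  using h_sym g_sym[OF assms] by (simp add: warped_metric_def transpose_block_diag transpose_scalar)

lemma christoffel_W_symmetric:
  "right_part y \<in> U \<Longrightarrow> christoffel W C A B y = christoffel W C B A y"
  by (rule christoffel_symmetric[OF open_right_part[OF open_U]]) (auto simp: W_symmetric)

lemma christoffel_W:
  assumes y: "right_part y \<in> U"
  shows "christoffel W (Inl k) (Inl i) (Inl j) y = christoffel h k i j (left_part y)"
    "christoffel W (Inr c) (Inl i) (Inl j) y = 0"
    "christoffel W (Inl k) (Inl i) (Inr b) y = 0"
    "christoffel W (Inl k) (Inr b) (Inl i) y = 0"
    "christoffel W (Inr c) (Inl i) (Inr b) y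
      = (if b = c then partial_deriv i F (left_part y) / F (left_part y) else 0)"
    "christoffel W (Inr c) (Inr b) (Inl i) y
      = (if b = c then partial_deriv i F (left_part y) / F (left_part y) else 0)"
    "christoffel W (Inl k) (Inr a) (Inr b) y
      = - (F (left_part y) * gradient h F k (left_part y)) * g (right_part y) $ a $ b"
    "christoffel W (Inr c) (Inr a) (Inr b) y = christoffel g c a b (right_part y)"
proof -
  note [simp] = inv_W[OF y] partial_deriv_W[OF y] sum_UNIV_Plus F_nz
  show "christoffel W (Inl k) (Inl i) (Inl j) y = christoffel h k i j (left_part y)"
    "christoffel W (Inr c) (Inl i) (Inl j) y = 0"
    "christoffel W (Inl k) (Inl i) (Inr b) y = 0"
    by (simp_all add: christoffel_def)
  then show "christoffel W (Inl k) (Inr b) (Inl i) y = 0"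
    using christoffel_W_symmetric[OF y] by metis
  have "(\<Sum>d\<in>UNIV. matrix_inv (g (right_part y)) $ c $ d * g (right_part y) $ b $ d) = mat 1 $ c $ b"
  proof -
    have "g (right_part y) $ b $ d = g (right_part y) $ d $ b" for d
      by (rule transpose_nth_eq[OF g_sym[OF y]])
    then have "(\<Sum>d\<in>UNIV. matrix_inv (g (right_part y)) $ c $ d * g (right_part y) $ b $ d)
        = (matrix_inv (g (right_part y)) ** g (right_part y)) $ c $ b"
      by (simp add: matrix_matrix_mult_def)
    then show ?thesis by (simp add: matrix_inv_mult g_inv y)
  qed
  moreover have "christoffel W (Inr c) (Inl i) (Inr b) y
    = partial_deriv i F (left_part y) / F (left_part y) *
        (\<Sum>d\<in>UNIV. matrix_inv (g (right_part y)) $ c $ d * g (right_part y) $ b $ d)"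
    by (simp add: christoffel_def sum_distrib_left power2_eq_square mult_ac)
  ultimately show *: "christoffel W (Inr c) (Inl i) (Inr b) y
      = (if b = c then partial_deriv i F (left_part y) / F (left_part y) else 0)"
    by (simp add: mat_def)
  then show "christoffel W (Inr c) (Inr b) (Inl i) y
      = (if b = c then partial_deriv i F (left_part y) / F (left_part y) else 0)"
    using christoffel_W_symmetric[OF y] by metis
  show "christoffel W (Inl k) (Inr a) (Inr b) y
      = - (F (left_part y) * gradient h F k (left_part y)) * g (right_part y) $ a $ b"
    by (simp add: christoffel_def gradient_def sum_distrib_left sum_distrib_right sum_negf mult_ac)
  show "christoffel W (Inr c) (Inr a) (Inr b) y = christoffel g c a b (right_part y)"
    by (simp add: christoffel_def distrib_left[symmetric] right_diff_distrib[symmetric])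
qed

text \<open>The formulas for the Christoffel symbols hold only over \<open>U\<close>; since \<open>U\<close> is open this suffices to
  differentiate them.\<close>
lemma partial_deriv_chartwise:
  assumes y: "right_part y \<in> U"
    and eq: "\<And>y. right_part y \<in> U \<Longrightarrow> f y = H (left_part y) (right_part y)"
  shows "partial_deriv (Inl i) f y = partial_deriv i (\<lambda>x. H x (right_part y)) (left_part y)"
    "partial_deriv (Inr j) f y = partial_deriv j (\<lambda>z. H (left_part y) z) (right_part y)"
proof -
  have "partial_deriv K f y = partial_deriv K (\<lambda>y. H (left_part y) (right_part y)) y" for K
    by (rule partial_deriv_cong[OF open_right_part[OF open_U]]) (use y eq in auto)
  then show "partial_deriv (Inl i) f y = partial_deriv i (\<lambda>x. H x (right_part y)) (left_part y)"
    "partial_deriv (Inr j) f y = partial_deriv j (\<lambda>z. H (left_part y) z) (right_part y)"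
    by (simp_all add: partial_deriv_parts)
qed

lemma partial_deriv_zero:
  assumes "right_part y \<in> U" "\<And>y. right_part y \<in> U \<Longrightarrow> f y = 0"
  shows "partial_deriv K f y = 0"
  using partial_deriv_chartwise[where f=f and H="\<lambda>x z. 0", OF assms] by (cases K) auto

lemma partial_deriv_christoffel_W:
  assumes y: "right_part y \<in> U"
  shows "partial_deriv (Inl l) (christoffel W (Inl k) (Inl i) (Inl j)) y
      = partial_deriv l (christoffel h k i j) (left_part y)"
    "partial_deriv (Inr d) (christoffel W (Inl k) (Inl i) (Inl j)) y = 0"
    "partial_deriv K (christoffel W (Inr c) (Inl i) (Inl j)) y = 0"
    "partial_deriv K (christoffel W (Inl k) (Inl i) (Inr b)) y = 0"
    "partial_deriv K (christoffel W (Inl k) (Inr b) (Inl i)) y = 0"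
    "partial_deriv (Inl j) (christoffel W (Inr c) (Inl i) (Inr c)) y
      = partial_deriv j (partial_deriv i F) (left_part y) / F (left_part y)
        - partial_deriv i F (left_part y) * partial_deriv j F (left_part y) / (F (left_part y))\<^sup>2"
    "partial_deriv (Inr d) (christoffel W (Inr c) (Inl i) (Inr b)) y = 0"
    "partial_deriv (Inr d) (christoffel W (Inr c) (Inr b) (Inl i)) y = 0"
    "partial_deriv (Inl l) (christoffel W (Inl k) (Inr a) (Inr b)) y
      = - (F (left_part y) * partial_deriv l (gradient h F k) (left_part y)
           + partial_deriv l F (left_part y) * gradient h F k (left_part y)) * g (right_part y) $ a $ b"
    "partial_deriv (Inr d) (christoffel W (Inr c) (Inr a) (Inr b)) y
      = partial_deriv d (christoffel g c a b) (right_part y)"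
    "partial_deriv (Inl l) (christoffel W (Inr c) (Inr a) (Inr b)) y = 0"
proof -
  note pd = partial_deriv_chartwise[OF y] and pz = partial_deriv_zero[OF y]
  show "partial_deriv (Inl l) (christoffel W (Inl k) (Inl i) (Inl j)) y
      = partial_deriv l (christoffel h k i j) (left_part y)"
    by (subst pd(1)[where H="\<lambda>x z. christoffel h k i j x"]) (simp_all add: christoffel_W)
  show "partial_deriv (Inr d) (christoffel W (Inl k) (Inl i) (Inl j)) y = 0"
    by (subst pd(2)[where H="\<lambda>x z. christoffel h k i j x"]) (simp_all add: christoffel_W)
  show "partial_deriv K (christoffel W (Inr c) (Inl i) (Inl j)) y = 0"
    "partial_deriv K (christoffel W (Inl k) (Inl i) (Inr b)) y = 0"
    "partial_deriv K (christoffel W (Inl k) (Inr b) (Inl i)) y = 0"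
    by (rule pz, simp add: christoffel_W)+
  show "partial_deriv (Inl j) (christoffel W (Inr c) (Inl i) (Inr c)) y
      = partial_deriv j (partial_deriv i F) (left_part y) / F (left_part y)
        - partial_deriv i F (left_part y) * partial_deriv j F (left_part y) / (F (left_part y))\<^sup>2"
    by (subst pd(1)[where H="\<lambda>x z. partial_deriv i F x / F x"])
      (simp_all add: christoffel_W partial_deriv_divide dF_diff F_diff F_nz)
  show "partial_deriv (Inr d) (christoffel W (Inr c) (Inl i) (Inr b)) y = 0"
    "partial_deriv (Inr d) (christoffel W (Inr c) (Inr b) (Inl i)) y = 0"
    by (subst pd(2)[where H="\<lambda>x z. if b = c then partial_deriv i F x / F x else 0"];
        simp add: christoffel_W)+
  show "partial_deriv (Inl l) (christoffel W (Inl k) (Inr a) (Inr b)) y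
      = - (F (left_part y) * partial_deriv l (gradient h F k) (left_part y)
           + partial_deriv l F (left_part y) * gradient h F k (left_part y)) * g (right_part y) $ a $ b"
  proof -
    have "partial_deriv (Inl l) (christoffel W (Inl k) (Inr a) (Inr b)) y
      = partial_deriv l (\<lambda>x. (F x * gradient h F k x) * (- g (right_part y) $ a $ b)) (left_part y)"
      by (subst pd(1)[where H="\<lambda>x z. (F x * gradient h F k x) * (- g z $ a $ b)"])
        (simp_all add: christoffel_W)
    also have "\<dots> = partial_deriv l (\<lambda>x. F x * gradient h F k x) (left_part y)
        * (- g (right_part y) $ a $ b)"
      by (intro partial_deriv_cmult differentiable_mult F_diff grad_diff)
    finally show ?thesis by (simp add: partial_deriv_mult F_diff grad_diff algebra_simps)
  qed
  show "partial_deriv (Inr d) (christoffel W (Inr c) (Inr a) (Inr b)) y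
      = partial_deriv d (christoffel g c a b) (right_part y)"
    by (subst pd(2)[where H="\<lambda>x z. christoffel g c a b z"]) (simp_all add: christoffel_W)
  show "partial_deriv (Inl l) (christoffel W (Inr c) (Inr a) (Inr b)) y = 0"
    by (subst pd(1)[where H="\<lambda>x z. christoffel g c a b z"]) (simp_all add: christoffel_W)
qed

lemma christoffel_g_symmetric: "z \<in> U \<Longrightarrow> christoffel g c a b z = christoffel g c b a z"
  using christoffel_symmetric[OF open_U] g_sym by blast

text \<open>Only the components \<open>R\<^sup>K\<^sub>I\<^sub>K\<^sub>J\<close>, whose sum over \<open>K\<close> is the Ricci tensor, are computed. Every fibre
  direction \<open>K = Inr c\<close> contributes the same multiple of the Hessian, hence the factor \<open>m\<close> in the trace.\<close>
lemma riemann_W_base_base: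
  assumes y: "right_part y \<in> U"
  shows "riemann W (Inl k) (Inl i) (Inl k) (Inl j) y = riemann h k i k j (left_part y)"
    "riemann W (Inr c) (Inl i) (Inr c) (Inl j) y = - hessian h F i j (left_part y) / F (left_part y)"
proof -
  show "riemann W (Inl k) (Inl i) (Inl k) (Inl j) y = riemann h k i k j (left_part y)"
    by (simp add: riemann_def sum_UNIV_Plus christoffel_W[OF y] partial_deriv_christoffel_W[OF y])
  show "riemann W (Inr c) (Inl i) (Inr c) (Inl j) y = - hessian h F i j (left_part y) / F (left_part y)"
    using F_nz[of "left_part y"]
    by (simp add: riemann_def sum_UNIV_Plus christoffel_W[OF y] partial_deriv_christoffel_W[OF y]
        sum_subtractf sum_negf sum_delta_mult hessian_def field_simps sum_distrib_left power2_eq_square)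
qed

text \<open>The trace over base directions assembles the divergence of the gradient. In a fibre direction
  \<open>c\<close> the correction is the curvature of a space form; the term subtracted for \<open>b = c\<close> turns the factor \<open>m\<close>
  into \<open>m - 1\<close> after summation over \<open>c\<close>.\<close>
lemma riemann_W_fibre_fibre:
  assumes y: "right_part y \<in> U"
  shows "riemann W (Inl k) (Inr a) (Inl k) (Inr b) y
      = - F (left_part y) * (partial_deriv k (gradient h F k) (left_part y)
          + (\<Sum>l\<in>UNIV. christoffel h k k l (left_part y) * gradient h F l (left_part y)))
        * g (right_part y) $ a $ b"
    "riemann W (Inr c) (Inr a) (Inr c) (Inr b) y
      = riemann g c a c b (right_part y) - grad_norm_sq h F (left_part y) *
         (g (right_part y) $ a $ b - (if b = c then g (right_part y) $ a $ c else 0))"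
proof -
  have s: "g (right_part y) $ b $ a = g (right_part y) $ a $ b"
    by (rule transpose_nth_eq[OF g_sym[OF y]])
  show "riemann W (Inl k) (Inr a) (Inl k) (Inr b) y
      = - F (left_part y) * (partial_deriv k (gradient h F k) (left_part y)
          + (\<Sum>l\<in>UNIV. christoffel h k k l (left_part y) * gradient h F l (left_part y)))
        * g (right_part y) $ a $ b"
    using F_nz[of "left_part y"]
    by (simp add: riemann_def sum_UNIV_Plus christoffel_W[OF y] partial_deriv_christoffel_W[OF y]
        sum_subtractf sum_negf sum_delta_mult s) (simp add: algebra_simps sum_distrib_left)
  show "riemann W (Inr c) (Inr a) (Inr c) (Inr b) y
      = riemann g c a c b (right_part y) - grad_norm_sq h F (left_part y) *
         (g (right_part y) $ a $ b - (if b = c then g (right_part y) $ a $ c else 0))"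
    using F_nz
    by (simp add: riemann_def sum_UNIV_Plus christoffel_W[OF y] partial_deriv_christoffel_W[OF y]
        sum_subtractf sum_negf sum_delta_mult s algebra_simps sum_distrib_left grad_norm_sq_def)
qed

text \<open>In the mixed blocks the only surviving terms are \<open>(\<partial>\<^sub>iF / F) (\<Gamma>\<^sup>c\<^sub>c\<^sub>b - \<Gamma>\<^sup>c\<^sub>b\<^sub>c)\<close>, which cancel by the symmetry
  of the Christoffel symbols of the fibre.\<close>
lemma ricci_W:
  assumes y: "right_part y \<in> U"
  shows "ricci W (Inl i) (Inl j) y = ricci h i j (left_part y)
      - real CARD('m) / F (left_part y) * hessian h F i j (left_part y)"
    "ricci W (Inl i) (Inr b) y = 0"
    "ricci W (Inr a) (Inl j) y = 0"
    "ricci W (Inr a) (Inr b) y = ricci g a b (right_part y)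
      - (F (left_part y) * laplacian h F (left_part y)
         + (real CARD('m) - 1) * grad_norm_sq h F (left_part y)) * g (right_part y) $ a $ b"
proof -
  note s = christoffel_g_symmetric[OF y]
  show "ricci W (Inl i) (Inl j) y = ricci h i j (left_part y)
      - real CARD('m) / F (left_part y) * hessian h F i j (left_part y)"
    by (simp add: ricci_def sum_UNIV_Plus riemann_W_base_base[OF y])
  have "riemann W (Inr c) (Inl i) (Inr c) (Inr b) y = 0" for c
    using s[of c c b]
    by (simp add: riemann_def sum_UNIV_Plus christoffel_W[OF y] partial_deriv_christoffel_W[OF y]
        sum_subtractf sum_delta_mult)
  moreover have "riemann W (Inl k) (Inl i) (Inl k) (Inr b) y = 0" for k
    by (simp add: riemann_def sum_UNIV_Plus christoffel_W[OF y] partial_deriv_christoffel_W[OF y])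
  ultimately show "ricci W (Inl i) (Inr b) y = 0" by (simp add: ricci_def sum_UNIV_Plus)
  have "riemann W (Inr c) (Inr a) (Inr c) (Inl j) y = 0" for c
    using s[of c c a]
    by (simp add: riemann_def sum_UNIV_Plus christoffel_W[OF y] partial_deriv_christoffel_W[OF y]
        sum_subtractf sum_delta_mult)
  moreover have "riemann W (Inl k) (Inr a) (Inl k) (Inl j) y = 0" for k
    by (simp add: riemann_def sum_UNIV_Plus christoffel_W[OF y] partial_deriv_christoffel_W[OF y])
  ultimately show "ricci W (Inr a) (Inl j) y = 0" by (simp add: ricci_def sum_UNIV_Plus)
  have "(\<Sum>k\<in>UNIV. riemann W (Inl k) (Inr a) (Inl k) (Inr b) y)
      = - F (left_part y) * laplacian h F (left_part y) * g (right_part y) $ a $ b"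
    by (simp only: riemann_W_fibre_fibre[OF y] laplacian_def sum_distrib_left sum_distrib_right)
  moreover have "(\<Sum>c\<in>UNIV. riemann W (Inr c) (Inr a) (Inr c) (Inr b) y)
      = ricci g a b (right_part y)
        - grad_norm_sq h F (left_part y) * (real CARD('m) - 1) * g (right_part y) $ a $ b"
    by (simp add: riemann_W_fibre_fibre[OF y] ricci_def sum_subtractf
        sum_distrib_left[symmetric]) (simp add: algebra_simps)
  ultimately show "ricci W (Inr a) (Inr b) y = ricci g a b (right_part y)
      - (F (left_part y) * laplacian h F (left_part y)
         + (real CARD('m) - 1) * grad_norm_sq h F (left_part y)) * g (right_part y) $ a $ b"
    by (simp add: ricci_def sum_UNIV_Plus algebra_simps)
qed

end

section \<open>A warped product over a coordinate space is a semi-Riemannian manifold\<close>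

text \<open>A matrix \<open>Q\<close> that diagonalizes \<open>B\<close> diagonalizes \<open>c\<^sup>2 B\<close> once it is divided by \<open>c\<close>, so the warping
  function does not affect the signature.\<close>
lemma has_signature_block_diag:
  assumes A: "has_signature A s" and B: "has_signature B t" and "c \<noteq> 0"
  shows "has_signature (block_diag A (c\<^sup>2 *\<^sub>R B)) (case_sum s t)"
proof -
  obtain P where P: "invertible P" "transpose P ** A ** P = (\<chi> i j. if i = j then s i else 0)"
    using A by (auto simp: has_signature_def)
  obtain Q where Q: "invertible Q" "transpose Q ** B ** Q = (\<chi> i j. if i = j then t i else 0)"
    using B by (auto simp: has_signature_def)
  let ?R = "block_diag P ((1 / c) *\<^sub>R Q)"
  have "invertible ((1 / c) *\<^sub>R Q)" by (rule scalar_invertible) (use assms Q in auto)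
  then have "invertible ?R" using P by (intro invertible_block_diag)
  moreover have "transpose ?R ** block_diag A (c\<^sup>2 *\<^sub>R B) ** ?R
      = block_diag (transpose P ** A ** P) (transpose Q ** B ** Q)"
    using \<open>c \<noteq> 0\<close>
    by (simp add: transpose_block_diag block_diag_mult transpose_scalar matrix_scalar_ac
        scalar_matrix_assoc[symmetric] power2_eq_square)
  moreover have "\<dots> = (\<chi> i j. if i = j then case_sum s t i else 0)"
    unfolding P(2) Q(2) by (intro vec_Plus_eqI) simp_all
  ultimately show ?thesis unfolding has_signature_def by (intro exI[of _ ?R] conjI) simp_all
qed

lemma param_coordinate_space [simp]: "param (coordinate_space h) c x = x"
  by (simp add: param_def coordinate_space_def inv_into_def)

lemma image_of_coordinate_space [simp]: "image_of (coordinate_space h) c = UNIV"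
  by (simp add: image_of_def coordinate_space_def)

lemma coordinate_space_simps:
  "charts (coordinate_space h) = UNIV" "metric (coordinate_space h) c = h"
  by (simp_all add: coordinate_space_def)

lemma continuous_on_join_parts:
  assumes "continuous_on S u" "continuous_on S v"
  shows "continuous_on S (\<lambda>x. join_parts (u x) (v x))"
  unfolding join_parts_def
proof (rule continuous_on_vec_lambda)
  fix k show "continuous_on S (\<lambda>x. case k of Inl i \<Rightarrow> u x $ i | Inr j \<Rightarrow> v x $ j)"
    by (cases k) (use assms in \<open>auto intro: continuous_on_component\<close>)
qed

lemma semi_riemannian_metric:
  assumes "semi_riemannian_manifold M" "c \<in> charts M"
  shows "smooth_on (image_of M c) (\<lambda>z. metric M c z $ a $ b)"
    "z \<in> image_of M c \<Longrightarrow> transpose (metric M c z) = metric M c z"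
    "z \<in> image_of M c \<Longrightarrow> invertible (metric M c z)"
  using assms unfolding semi_riemannian_manifold_def by blast+

lemma semi_riemannian_signature:
  assumes "semi_riemannian_manifold M"
  obtains s where "\<forall>i. s i = 1 \<or> s i = -1"
    "\<forall>c\<in>charts M. \<forall>y\<in>image_of M c. has_signature (metric M c y) s"
  using assms unfolding semi_riemannian_manifold_def by blast

lemma semi_riemannian_coordinate_space:
  fixes h :: "real^'n::finite \<Rightarrow> real^'n^'n"
  assumes smooth: "\<And>i j. smooth_on UNIV (\<lambda>x. h x $ i $ j)"
    and sym: "\<And>x. transpose (h x) = h x" and inv: "\<And>x. invertible (h x)"
    and sig: "\<forall>i. s i = 1 \<or> s i = -1" "\<And>x. has_signature (h x) s"
  shows "semi_riemannian_manifold (coordinate_space h)"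
proof -
  have trans: "transition (coordinate_space h) c d = (\<lambda>x. x)" for c d
    by (simp add: transition_def fun_eq_iff) (simp add: coordinate_space_def)
  have jac: "jacobian_matrix (\<lambda>x :: real^'n. x) y = mat 1" for y
    by (auto simp: jacobian_matrix_def partial_deriv_nth mat_def vec_eq_iff)
  have param: "param (coordinate_space h) c = (\<lambda>x. x)" for c by (simp add: fun_eq_iff)
  have dom: "dom_of (coordinate_space h) c = UNIV" and coord: "coord (coordinate_space h) c = (\<lambda>x. x)" for c
    by (simp_all add: coordinate_space_def)
  have lin: "linear (\<lambda>x :: real^'n. x $ a)" for a by (rule linearI) auto
  have "smooth_manifold (coordinate_space h)"
    unfolding smooth_manifold_def image_of_coordinate_space param dom coord trans
    by (auto simp: coordinate_space_simps homeomorphism_def smooth_on_linear[OF lin])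
  then show ?thesis
    unfolding semi_riemannian_manifold_def image_of_coordinate_space dom coord trans jac
      coordinate_space_simps
    using smooth sym inv sig by auto
qed

locale warped_over_coordinates =
  fixes h :: "real^'n::finite \<Rightarrow> real^'n^'n" and F :: "real^'n \<Rightarrow> real"
    and N :: "('q::{t2_space,second_countable_topology}, 'd, 'm::finite) metric_atlas"
  assumes h: "semi_riemannian_manifold (coordinate_space h)"
    and N: "semi_riemannian_manifold N"
    and F_smooth: "smooth_on UNIV F" and F_nz: "F x \<noteq> 0"
begin

abbreviation "X \<equiv> warped_product (coordinate_space h) F N"

lemma chart_N:
  assumes "d \<in> charts N"
  shows "open (dom_of N d)" "open (image_of N d)"
    "homeomorphism (dom_of N d) (image_of N d) (coord N d) (param N d)"
  using N assms by (auto simp: semi_riemannian_manifold_def smooth_manifold_def)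

lemma X_simps:
  "charts X = UNIV \<times> charts N" "dom_of X (c, d) = UNIV \<times> dom_of N d"
  "coord X (c, d) (x, q) = join_parts x (coord N d q)"
  "metric X (c, d) = warped_metric h F (metric N d)"
  by (simp_all add: warped_product_def coordinate_space_def warped_metric_def fun_eq_iff
      param_coordinate_space[unfolded coordinate_space_def])

lemma coord_image_X:
  "coord X (c, d) ` (UNIV \<times> D) = right_part -` (coord N d ` D)"
proof -
  have "y \<in> coord X (c, d) ` (UNIV \<times> D)" if "right_part y = coord N d q" "q \<in> D" for y q
  proof -
    have "y = coord X (c, d) (left_part y, q)" by (simp add: X_simps that(1)[symmetric])
    then show ?thesis using that(2) by blast
  qed
  then show ?thesis by (auto simp: X_simps)
qed

lemma image_of_X: "image_of X (c, d) = right_part -` image_of N d"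
  by (simp add: image_of_def coord_image_X X_simps(2))

text \<open>\<open>param\<close> is a choice of preimage, so it is determined only over the image of the chart. All
  statements about transition maps are therefore restricted to that open set.\<close>
lemma param_X:
  assumes d: "d \<in> charts N" and y: "right_part y \<in> image_of N d"
  shows "param X (c, d) y = (left_part y, param N d (right_part y))"
  unfolding param_def
proof (rule inv_into_f_eq)
  have "inj_on (coord N d) (dom_of N d)"
    using chart_N(3)[OF d] by (metis homeomorphism_apply1 inj_on_inverseI)
  then show "inj_on (coord X (c, d)) (dom_of X (c, d))"
    by (auto simp: inj_on_def X_simps) (metis left_join, metis right_join)
  show "(left_part y, inv_into (dom_of N d) (coord N d) (right_part y)) \<in> dom_of X (c, d)"
    using y by (auto simp: X_simps image_of_def inv_into_into)
  show "coord X (c, d) (left_part y, inv_into (dom_of N d) (coord N d) (right_part y)) = y"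
    using y by (simp add: X_simps image_of_def f_inv_into_f)
qed

lemma transition_X:
  assumes "d \<in> charts N" "right_part y \<in> image_of N d"
  shows "transition X (c, d) (c', d') y = join_parts (left_part y) (transition N d d' (right_part y))"
  by (simp add: transition_def param_X[OF assms] X_simps)

lemma homeomorphism_X:
  assumes d: "d \<in> charts N"
  shows "homeomorphism (dom_of X (c, d)) (image_of X (c, d)) (coord X (c, d)) (param X (c, d))"
proof (rule homeomorphismI)
  note hN = chart_N(3)[OF d]
  have "continuous_on (UNIV \<times> dom_of N d) (\<lambda>z. coord N d (snd z))"
    by (rule continuous_on_compose2[OF homeomorphism_cont1[OF hN] continuous_on_snd[OF continuous_on_id]]) auto
  then have "continuous_on (UNIV \<times> dom_of N d) (\<lambda>z. join_parts (fst z) (coord N d (snd z)))"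
    by (rule continuous_on_join_parts[OF continuous_on_fst[OF continuous_on_id]])
  moreover have "coord X (c, d) = (\<lambda>z. join_parts (fst z) (coord N d (snd z)))"
    by (auto simp: fun_eq_iff X_simps)
  ultimately show "continuous_on (dom_of X (c, d)) (coord X (c, d))"
    by (simp only: X_simps(2))
  have lin: "continuous_on S left_part" "continuous_on S right_part" for S :: "(real^('n + 'm)) set"
    by (rule linear_continuous_on, rule linear_conv_bounded_linear[THEN iffD1],
        rule linear_left_part linear_right_part)+
  have "continuous_on (right_part -` image_of N d) (\<lambda>y :: real^('n + 'm). param N d (right_part y))"
    by (rule continuous_on_compose2[OF homeomorphism_cont2[OF hN] lin(2)]) auto
  then have "continuous_on (right_part -` image_of N d)
      (\<lambda>y :: real^('n + 'm). (left_part y, param N d (right_part y)))"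
    by (rule continuous_on_Pair[OF lin(1)])
  then show "continuous_on (image_of X (c, d)) (param X (c, d))"
    unfolding image_of_X by (rule continuous_on_eq) (simp add: param_X[OF d])
  show "coord X (c, d) ` dom_of X (c, d) \<subseteq> image_of X (c, d)" by (simp add: image_of_def)
  show "param X (c, d) ` image_of X (c, d) \<subseteq> dom_of X (c, d)"
    using homeomorphism_image2[OF hN] by (auto simp: image_of_X param_X d X_simps)
  show "param X (c, d) (coord X (c, d) z) = z" if "z \<in> dom_of X (c, d)" for z
    using that homeomorphism_apply1[OF hN]
    by (cases z) (auto simp: X_simps param_X d image_of_def)
  show "coord X (c, d) (param X (c, d) y) = y" if "y \<in> image_of X (c, d)" for y
    using that homeomorphism_apply2[OF hN] by (auto simp: image_of_X param_X d X_simps)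
qed

lemma overlap_N:
  assumes "d \<in> charts N" "d' \<in> charts N"
  shows "open (coord N d ` (dom_of N d \<inter> dom_of N d'))"
    "coord N d ` (dom_of N d \<inter> dom_of N d') \<subseteq> image_of N d"
proof -
  have "openin (top_of_set (image_of N d)) (coord N d ` (dom_of N d \<inter> dom_of N d'))"
    using homeomorphism_imp_open_map[OF chart_N(3)[OF assms(1)]] chart_N(1)[OF assms(2)] by blast
  then show "open (coord N d ` (dom_of N d \<inter> dom_of N d'))"
    using chart_N(2)[OF assms(1)] openin_open_trans by blast
qed (auto simp: image_of_def)

lemma smooth_manifold_X: "smooth_manifold X"
  unfolding smooth_manifold_def
proof (intro conjI ballI allI)
  have "(\<Union>d\<in>charts N. dom_of N d) = UNIV"
    using N by (simp add: semi_riemannian_manifold_def smooth_manifold_def)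
  then have "\<exists>d\<in>charts N. q \<in> dom_of N d" for q by blast
  then show "(\<Union>c\<in>charts X. dom_of X c) = UNIV" by (auto simp: X_simps)
next
  fix e assume "e \<in> charts X"
  then obtain c d where e: "e = (c, d)" and d: "d \<in> charts N" by (auto simp: X_simps)
  show "open (dom_of X e)" using chart_N(1)[OF d] by (simp add: e X_simps open_Times)
  show "open (image_of X e)" using chart_N(2)[OF d] by (simp add: e image_of_X open_right_part)
  show "homeomorphism (dom_of X e) (image_of X e) (coord X e) (param X e)"
    by (simp only: e homeomorphism_X[OF d])
next
  fix e e' and K :: "'n + 'm" assume "e \<in> charts X" "e' \<in> charts X"
  then obtain c d c' d' where e: "e = (c, d)" "e' = (c', d')"
    and d: "d \<in> charts N" "d' \<in> charts N" by (auto simp: X_simps)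
  define V where "V = coord N d ` (dom_of N d \<inter> dom_of N d')"
  have V: "open V" "V \<subseteq> image_of N d" using overlap_N[OF d] by (auto simp: V_def)
  have S: "coord X e ` (dom_of X e \<inter> dom_of X e') = right_part -` V"
    by (simp add: e X_simps(2) Times_Int_Times coord_image_X V_def)
  have "smooth_on (right_part -` V) (\<lambda>y. join_parts (left_part y) (transition N d d' (right_part y)) $ K)"
  proof (cases K)
    case (Inl i)
    have "linear (\<lambda>y :: real^('n + 'm). y $ Inl i)" by (rule linearI) auto
    then show ?thesis using Inl by (simp add: smooth_on_linear)
  next
    case (Inr a)
    have "smooth_on V (\<lambda>z. transition N d d' z $ a)"
      using N d by (auto simp: V_def semi_riemannian_manifold_def smooth_manifold_def)
    from smooth_on_compose_right_part[OF this V(1)] show ?thesis using Inr by simp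
  qed
  then show "smooth_on (coord X e ` (dom_of X e \<inter> dom_of X e')) (\<lambda>y. transition X e e' y $ K)"
    unfolding S
    by (rule smooth_on_cong[OF open_right_part[OF V(1)], rotated])
      (use V(2) in \<open>auto simp: e transition_X[OF d(1)]\<close>)
qed

lemma jacobian_transition_X:
  assumes d: "d \<in> charts N" "d' \<in> charts N"
    and y: "right_part y \<in> coord N d ` (dom_of N d \<inter> dom_of N d')"
  shows "jacobian_matrix (transition X (c, d) (c', d')) y
    = block_diag (mat 1) (jacobian_matrix (transition N d d') (right_part y))"
proof -
  define V where "V = coord N d ` (dom_of N d \<inter> dom_of N d')"
  have V: "open V" "V \<subseteq> image_of N d" using overlap_N[OF d] by (auto simp: V_def)
  have eq: "partial_deriv B (\<lambda>z. transition X ((), d) ((), d') z $ A) y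
      = partial_deriv B (\<lambda>z. join_parts (left_part z) (transition N d d' (right_part z)) $ A) y" for A B
    by (rule partial_deriv_cong[OF open_right_part[OF V(1)]])
      (use V(2) y in \<open>auto simp: V_def[symmetric] transition_X[OF d(1)]\<close>)
  have l: "partial_deriv (Inl i) (\<lambda>z. left_part z $ j) y = mat 1 $ j $ i"
    "partial_deriv (Inr b) (\<lambda>z. left_part z $ j) y = 0" for i j b
    using partial_deriv_parts[of _ "\<lambda>x z. x $ j" y] by (simp_all add: partial_deriv_nth mat_def)
  have r: "partial_deriv (Inl i) (\<lambda>z. transition N d d' (right_part z) $ a) y = 0"
    "partial_deriv (Inr b) (\<lambda>z. transition N d d' (right_part z) $ a) y
      = partial_deriv b (\<lambda>z. transition N d d' z $ a) (right_part y)" for i a b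
    using partial_deriv_parts[of _ "\<lambda>x z. transition N d d' z $ a" y] by simp_all
  show ?thesis
    by (intro vec_Plus_eqI)
      (simp_all add: jacobian_matrix_def eq l[unfolded left_part_nth] r)
qed

lemmas metric_N = semi_riemannian_metric[OF N]

lemma metric_h:
  "smooth_on UNIV (\<lambda>x. h x $ i $ j)" "transpose (h x) = h x" "invertible (h x)"
  using semi_riemannian_metric[OF h, of "()"] by (simp_all add: coordinate_space_simps)

text \<open>Transition maps of the product atlas are the identity on the base times a transition map of the
  fibre. Hence the Jacobian is block diagonal, and \<open>F\<^sup>2\<close>, which depends on the base point only, passes
  through the transformation law.\<close>
lemma semi_riemannian_X: "semi_riemannian_manifold X"
  unfolding semi_riemannian_manifold_def
proof (intro conjI ballI allI smooth_manifold_X)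
  fix e and K L :: "'n + 'm" assume "e \<in> charts X"
  then obtain c d where e: "e = (c, d)" and d: "d \<in> charts N" by (auto simp: X_simps)
  note o = chart_N(2)[OF d]
  have hl: "smooth_on (right_part -` image_of N d) (\<lambda>y :: real^('n + 'm). h (left_part y) $ i $ j)" for i j
    by (rule smooth_on_subset[OF smooth_on_compose_left_part[OF metric_h(1)]]) simp
  have F2: "smooth_on UNIV (\<lambda>x. (F x)\<^sup>2)"
    unfolding power2_eq_square by (intro smooth_on_mult F_smooth open_UNIV)
  have gr: "smooth_on (right_part -` image_of N d)
      (\<lambda>y :: real^('n + 'm). (F (left_part y))\<^sup>2 * metric N d (right_part y) $ a $ b)" for a b
    by (intro smooth_on_mult open_right_part o smooth_on_compose_right_part metric_N(1)[OF d]
        smooth_on_subset[OF smooth_on_compose_left_part[OF F2]]) simp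
  show "smooth_on (image_of X e) (\<lambda>y. metric X e y $ K $ L)"
    unfolding e image_of_X X_simps
    by (cases K; cases L) (simp_all add: warped_metric_def hl[unfolded left_part_nth] gr smooth_on_const)
next
  fix e y assume "e \<in> charts X" and y: "y \<in> image_of X e"
  then obtain c d where e: "e = (c, d)" and d: "d \<in> charts N" by (auto simp: X_simps)
  have y: "right_part y \<in> image_of N d" using y by (simp add: e image_of_X)
  show "transpose (metric X e y) = metric X e y"
    by (simp add: e X_simps warped_metric_def transpose_block_diag transpose_scalar
        metric_N[OF d] y metric_h)
  show "invertible (metric X e y)"
    unfolding e X_simps warped_metric_def
    by (intro invertible_block_diag scalar_invertible) (auto simp: metric_N[OF d] y metric_h F_nz)
next
  fix e e' y assume "e \<in> charts X" "e' \<in> charts X"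
    and y: "y \<in> coord X e ` (dom_of X e \<inter> dom_of X e')"
  then obtain c d c' d' where e: "e = (c, d)" "e' = (c', d')"
    and d: "d \<in> charts N" "d' \<in> charts N" by (auto simp: X_simps)
  have y: "right_part y \<in> coord N d ` (dom_of N d \<inter> dom_of N d')"
    using y by (simp add: e X_simps(2) Times_Int_Times coord_image_X)
  then have i: "right_part y \<in> image_of N d" using overlap_N[OF d] by auto
  have "metric N d (right_part y) =
      transpose (jacobian_matrix (transition N d d') (right_part y))
        ** metric N d' (transition N d d' (right_part y))
        ** jacobian_matrix (transition N d d') (right_part y)"
    using N d y unfolding semi_riemannian_manifold_def by blast
  then show "metric X e y = transpose (jacobian_matrix (transition X e e') y)
      ** metric X e' (transition X e e' y) ** jacobian_matrix (transition X e e') y"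
    by (simp add: e X_simps warped_metric_def jacobian_transition_X[OF d y] transition_X[OF d(1) i]
        transpose_block_diag block_diag_mult matrix_scalar_ac scalar_matrix_assoc[symmetric])
next
  obtain s where s: "\<forall>i. s i = 1 \<or> s i = -1" "\<forall>x. has_signature (h x) s"
    using semi_riemannian_signature[OF h] by (auto simp: coordinate_space_simps)
  obtain t where t: "\<forall>i. t i = 1 \<or> t i = -1"
      "\<forall>d\<in>charts N. \<forall>z\<in>image_of N d. has_signature (metric N d z) t"
    using semi_riemannian_signature[OF N] by blast
  have "case_sum s t K = 1 \<or> case_sum s t K = -1" for K
    using s(1) t(1) by (cases K) auto
  moreover have "has_signature (metric X e y) (case_sum s t)"
    if "e \<in> charts X" "y \<in> image_of X e" for e y
    using that s(2) t(2) F_nz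
    by (auto simp: X_simps image_of_X warped_metric_def intro!: has_signature_block_diag)
  ultimately show "\<exists>s. (\<forall>i. s i = 1 \<or> s i = -1) \<and>
      (\<forall>c\<in>charts X. \<forall>y\<in>image_of X c. has_signature (metric X c y) s)" by blast
qed

end

section \<open>Conformally flat metrics that depend on one linear form\<close>

lemma DERIV_differentiable: "(u has_real_derivative D) (at x) \<Longrightarrow> u differentiable (at x)"
  by (auto simp: real_differentiable_def)

lemma linear_lin_form: "linear (lin_form \<alpha>)"
  by (rule linearI) (auto simp: lin_form_def algebra_simps sum.distrib sum_distrib_left)

lemma lin_form_axis: "lin_form \<alpha> (axis i c) = \<alpha> i * c"
proof -
  have "lin_form \<alpha> (axis i c) = (\<Sum>k\<in>UNIV. if k = i then \<alpha> k * c else 0)"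
    unfolding lin_form_def axis_def by (rule sum.cong) auto
  then show ?thesis by simp
qed

lemma differentiable_lin_form:
  "u differentiable (at (lin_form \<alpha> x)) \<Longrightarrow> (\<lambda>x. u (lin_form \<alpha> x)) differentiable (at x)"
  by (rule differentiable_compose_linear[OF linear_lin_form])

lemma partial_deriv_lin_form:
  fixes u :: "real \<Rightarrow> real"
  assumes "u differentiable (at (lin_form \<alpha> x))"
  shows "partial_deriv i (\<lambda>x. u (lin_form \<alpha> x)) x = \<alpha> i * deriv u (lin_form \<alpha> x)"
  unfolding partial_deriv_def
  using dir_deriv_compose_linear[OF linear_lin_form, of \<alpha> "axis i 1" "\<alpha> i" 1 u x] assms
  by (simp add: lin_form_axis dir_deriv_one)

lemma pseudo_euclidean_square:
  assumes "\<forall>i. \<epsilon> i = 1 \<or> \<epsilon> i = -1"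
  shows "pseudo_euclidean \<epsilon> ** pseudo_euclidean \<epsilon> = mat 1"
proof -
  have "\<epsilon> i * \<epsilon> i = 1" for i using assms[rule_format, of i] by auto
  then show ?thesis
    by (simp add: matrix_matrix_mult_def pseudo_euclidean_def mat_def vec_eq_iff sum_delta_mult)
qed

lemma smooth_on_compose_lin_form:
  assumes "smooth_on UNIV u"
  shows "smooth_on UNIV (\<lambda>x :: real^'n::finite. u (lin_form \<alpha> x))"
proof -
  have "\<forall>b\<in>Basis. \<exists>c. \<exists>b'\<in>Basis. lin_form \<alpha> b = c *\<^sub>R b'"
    by simp
  from smooth_on_compose_linear[OF linear_lin_form this open_UNIV assms] show ?thesis by simp
qed

locale conformal_line =
  fixes \<epsilon> \<alpha> :: "'n::finite \<Rightarrow> real" and \<phi> :: "real \<Rightarrow> real" and \<kappa> :: real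
  assumes signs: "\<forall>i. \<epsilon> i = 1 \<or> \<epsilon> i = -1"
    and \<phi>_smooth: "smooth_on UNIV \<phi>" and \<phi>_nz: "\<phi> \<xi> \<noteq> 0"
    and \<kappa>: "(\<Sum>k\<in>UNIV. \<epsilon> k * (\<alpha> k)\<^sup>2) = \<kappa>"
begin

abbreviation "gbar \<equiv> conformal_metric \<epsilon> (\<lambda>x. \<phi> (lin_form \<alpha> x))"

text \<open>The Christoffel symbols of the conformal metric are \<open>- p\<close> times the constants \<open>C\<close>, where \<open>p\<close>
  is the logarithmic derivative of \<open>\<phi>\<close>. All tensor algebra is thus done with constants.\<close>
definition "p \<xi> = deriv \<phi> \<xi> / \<phi> \<xi>"

definition "C k i j = \<alpha> i * (if j = k then 1 else 0) + \<alpha> j * (if i = k then 1 else 0)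
  - \<epsilon> k * \<alpha> k * (if i = j then \<epsilon> i else 0)"

lemma sign_square: "\<epsilon> i * \<epsilon> i = 1" using signs[rule_format, of i] by auto

lemma smooth_deriv_\<phi>: "smooth_on UNIV (deriv \<phi>)" by (rule smooth_on_deriv[OF \<phi>_smooth])

lemma DERIV_\<phi>: "(\<phi> has_real_derivative deriv \<phi> \<xi>) (at \<xi>)"
  "(deriv \<phi> has_real_derivative deriv (deriv \<phi>) \<xi>) (at \<xi>)"
  by (rule smooth_on_DERIV[OF \<phi>_smooth UNIV_I] smooth_on_DERIV[OF smooth_deriv_\<phi> UNIV_I])+

lemma DERIV_p: "(p has_real_derivative deriv (deriv \<phi>) \<xi> / \<phi> \<xi> - (p \<xi>)\<^sup>2) (at \<xi>)"
  unfolding p_def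
  by (rule derivative_eq_intros DERIV_\<phi> \<phi>_nz refl)+ (simp add: \<phi>_nz field_simps power2_eq_square)

lemma gbar_nth: "gbar x $ i $ j = 1 / (\<phi> (lin_form \<alpha> x))\<^sup>2 * (if i = j then \<epsilon> i else 0)"
  by (simp add: conformal_metric_def pseudo_euclidean_def)

lemma transpose_pseudo_euclidean: "transpose (pseudo_euclidean \<epsilon>) = pseudo_euclidean \<epsilon>"
  by (auto simp: transpose_def pseudo_euclidean_def vec_eq_iff)

lemma transpose_gbar: "transpose (gbar x) = gbar x"
  by (simp add: conformal_metric_def transpose_scalar transpose_pseudo_euclidean)

lemma invertible_gbar: "invertible (gbar x)"
  unfolding conformal_metric_def
  by (intro scalar_invertible) (use \<phi>_nz pseudo_euclidean_square[OF signs] in \<open>auto simp: invertible_def\<close>)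

lemma inv_gbar: "matrix_inv (gbar x) $ i $ j = (\<phi> (lin_form \<alpha> x))\<^sup>2 * (if i = j then \<epsilon> i else 0)"
proof -
  have "invertible (pseudo_euclidean \<epsilon>)" "matrix_inv (pseudo_euclidean \<epsilon>) = pseudo_euclidean \<epsilon>"
    using pseudo_euclidean_square[OF signs] by (auto simp: invertible_def intro: matrix_inv_eqI)
  then show ?thesis
    unfolding conformal_metric_def by (subst matrix_inv_scaleR) (auto simp: \<phi>_nz pseudo_euclidean_def)
qed

lemma partial_deriv_gbar:
  "partial_deriv k (\<lambda>x. gbar x $ i $ j) x
    = - 2 * p (lin_form \<alpha> x) / (\<phi> (lin_form \<alpha> x))\<^sup>2 * \<alpha> k * (if i = j then \<epsilon> i else 0)"
proof -
  have D: "((\<lambda>\<xi>. 1 / (\<phi> \<xi>)\<^sup>2 * c) has_real_derivative - 2 * p \<xi> / (\<phi> \<xi>)\<^sup>2 * c) (at \<xi>)" for \<xi> c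
    unfolding p_def
    by (rule derivative_eq_intros DERIV_\<phi> refl | simp add: \<phi>_nz)+
      (simp add: \<phi>_nz field_simps eval_nat_numeral)
  show ?thesis
    unfolding gbar_nth
    using partial_deriv_lin_form[of "\<lambda>\<xi>. 1 / (\<phi> \<xi>)\<^sup>2 * (if i = j then \<epsilon> i else 0)" \<alpha> x k]
      DERIV_imp_deriv[OF D] DERIV_differentiable[OF D]
    by simp
qed

lemma christoffel_gbar: "christoffel gbar k i j x = - p (lin_form \<alpha> x) * C k i j"
proof -
  let ?\<xi> = "lin_form \<alpha> x"
  have "christoffel gbar k i j x = 1/2 * ((\<phi> ?\<xi>)\<^sup>2 * \<epsilon> k *
      (partial_deriv i (\<lambda>z. gbar z $ j $ k) x + partial_deriv j (\<lambda>z. gbar z $ i $ k) x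
        - partial_deriv k (\<lambda>z. gbar z $ i $ j) x))"
    unfolding christoffel_def inv_gbar mult.assoc sum_distrib_left[symmetric] by (simp add: sum_delta_mult)
  also have "\<dots> = - p ?\<xi> * C k i j"
    using \<phi>_nz[of ?\<xi>] sign_square[of k]
    by (auto simp: partial_deriv_gbar C_def field_simps)
  finally show ?thesis .
qed

lemma partial_deriv_christoffel_gbar:
  "partial_deriv l (christoffel gbar k i j) x
    = - (deriv (deriv \<phi>) (lin_form \<alpha> x) / \<phi> (lin_form \<alpha> x) - (p (lin_form \<alpha> x))\<^sup>2) * \<alpha> l * C k i j"
proof -
  have D: "((\<lambda>\<xi>. - p \<xi> * C k i j) has_real_derivative
      - (deriv (deriv \<phi>) \<xi> / \<phi> \<xi> - (p \<xi>)\<^sup>2) * C k i j) (at \<xi>)" for \<xi>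
    by (rule derivative_eq_intros DERIV_p refl | simp)+
  have "christoffel gbar k i j = (\<lambda>x. - p (lin_form \<alpha> x) * C k i j)"
    by (simp add: christoffel_gbar fun_eq_iff)
  then show ?thesis
    using partial_deriv_lin_form[of "\<lambda>\<xi>. - p \<xi> * C k i j" \<alpha> x l]
      DERIV_imp_deriv[OF D] DERIV_differentiable[OF D] by simp
qed

text \<open>Contracting the constants with a vector produces three terms, one for each Kronecker delta; the
  quadratic contraction below is obtained by applying this to \<open>C\<close> itself.\<close>
lemma C_apply:
  "(\<Sum>a\<in>UNIV. C k j a * X a)
    = \<alpha> j * X k + (if j = k then (\<Sum>a\<in>UNIV. \<alpha> a * X a) else 0) - \<epsilon> k * \<alpha> k * \<epsilon> j * X j"
proof -
  have "C k j a * X a = \<alpha> j * X a * (if k = a then 1 else 0) + (if j = k then \<alpha> a * X a else 0)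
      - \<epsilon> k * \<alpha> k * \<epsilon> j * X a * (if j = a then 1 else 0)" for a
    by (auto simp: C_def algebra_simps)
  then show ?thesis by (simp add: sum.distrib sum_subtractf sum_delta_mult)
qed

lemma C_contractions:
  "(\<Sum>k\<in>UNIV. \<alpha> k * C k i j) = 2 * \<alpha> i * \<alpha> j - \<kappa> * (if i = j then \<epsilon> i else 0)"
  "(\<Sum>k\<in>UNIV. C k i k) = real CARD('n) * \<alpha> i"
  "(\<Sum>k\<in>UNIV. C k k i) = real CARD('n) * \<alpha> i"
  "(\<Sum>k\<in>UNIV. \<Sum>a\<in>UNIV. C k j a * C a i k)
    = (real CARD('n) + 2) * \<alpha> i * \<alpha> j - 2 * \<kappa> * (if i = j then \<epsilon> i else 0)"
proof -
  show c1: "(\<Sum>k\<in>UNIV. \<alpha> k * C k i j) = 2 * \<alpha> i * \<alpha> j - \<kappa> * (if i = j then \<epsilon> i else 0)" for i j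
  proof -
    have "\<alpha> k * C k i j = \<alpha> i * \<alpha> k * (if j = k then 1 else 0) + \<alpha> j * \<alpha> k * (if i = k then 1 else 0)
        - \<epsilon> k * (\<alpha> k)\<^sup>2 * (if i = j then \<epsilon> i else 0)" for k
      by (auto simp: C_def algebra_simps power2_eq_square)
    then show ?thesis
      by (simp add: sum.distrib sum_subtractf sum_delta_mult sum_distrib_right[symmetric] \<kappa>)
  qed
  have "C k i k = \<alpha> i + \<alpha> k * (if i = k then 1 else 0) - \<alpha> k * (if i = k then 1 else 0)" for k
    using sign_square[of k] by (auto simp: C_def)
  then show c2: "(\<Sum>k\<in>UNIV. C k i k) = real CARD('n) * \<alpha> i" by simp
  have "C k k i = C k i k" for k by (auto simp: C_def)
  with c2 show "(\<Sum>k\<in>UNIV. C k k i) = real CARD('n) * \<alpha> i" by simp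
  have c3: "(\<Sum>k\<in>UNIV. \<epsilon> k * \<alpha> k * C j i k) = (if i = j then \<kappa> else 0)"
  proof -
    have "\<epsilon> k * \<alpha> k * C j i k = \<alpha> i * \<epsilon> k * \<alpha> k * (if j = k then 1 else 0)
        + (if i = j then \<epsilon> k * (\<alpha> k)\<^sup>2 else 0)
        - \<epsilon> j * \<alpha> j * \<epsilon> i * \<epsilon> k * \<alpha> k * (if i = k then 1 else 0)" for k
      by (auto simp: C_def algebra_simps power2_eq_square)
    then show ?thesis
      using sign_square by (simp add: sum.distrib sum_subtractf sum_delta_mult \<kappa>)
  qed
  have "(\<Sum>k\<in>UNIV. \<Sum>a\<in>UNIV. C k j a * C a i k)
    = (\<Sum>k\<in>UNIV. \<alpha> j * C k i k + (if j = k then 2 * \<alpha> i * \<alpha> k - \<kappa> * (if i = k then \<epsilon> i else 0) else 0)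
        - \<epsilon> j * (\<epsilon> k * \<alpha> k * C j i k))"
    unfolding C_apply c1 by (rule sum.cong) auto
  also have "\<dots> = \<alpha> j * (real CARD('n) * \<alpha> i) + (2 * \<alpha> i * \<alpha> j - \<kappa> * (if i = j then \<epsilon> i else 0))
      - \<epsilon> j * (if i = j then \<kappa> else 0)"
    by (simp only: sum.distrib sum_subtractf sum_distrib_left[symmetric] c2 c3) simp
  finally show "(\<Sum>k\<in>UNIV. \<Sum>a\<in>UNIV. C k j a * C a i k)
    = (real CARD('n) + 2) * \<alpha> i * \<alpha> j - 2 * \<kappa> * (if i = j then \<epsilon> i else 0)"
    by (auto simp: algebra_simps)
qed

lemma ricci_gbar:
  "ricci gbar i j x = (real CARD('n) - 2) * (deriv (deriv \<phi>) (lin_form \<alpha> x) / \<phi> (lin_form \<alpha> x)) * \<alpha> i * \<alpha> j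
     + \<kappa> * (deriv (deriv \<phi>) (lin_form \<alpha> x) / \<phi> (lin_form \<alpha> x)
            - (real CARD('n) - 1) * (p (lin_form \<alpha> x))\<^sup>2) * (if i = j then \<epsilon> i else 0)"
proof -
  define P q d where "P = p (lin_form \<alpha> x)"
    and "q = deriv (deriv \<phi>) (lin_form \<alpha> x) / \<phi> (lin_form \<alpha> x)"
    and "d = (if i = j then \<epsilon> i else 0)"
  have "riemann gbar k i k j x = - (q - P\<^sup>2) * (\<alpha> k * C k i j - \<alpha> j * C k i k)
     + P\<^sup>2 * ((\<Sum>a\<in>UNIV. C k k a * C a i j) - (\<Sum>a\<in>UNIV. C k j a * C a i k))" for k
    unfolding riemann_def partial_deriv_christoffel_gbar P_def q_def
    by (simp add: christoffel_gbar sum_subtractf sum_distrib_left power2_eq_square algebra_simps)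
  then have "ricci gbar i j x = - (q - P\<^sup>2) * ((\<Sum>k\<in>UNIV. \<alpha> k * C k i j) - \<alpha> j * (\<Sum>k\<in>UNIV. C k i k))
     + P\<^sup>2 * ((\<Sum>k\<in>UNIV. \<Sum>a\<in>UNIV. C k k a * C a i j) - (\<Sum>k\<in>UNIV. \<Sum>a\<in>UNIV. C k j a * C a i k))"
    by (simp add: ricci_def sum.distrib sum_subtractf sum_distrib_left[symmetric] sum_distrib_right[symmetric])
  moreover have "(\<Sum>k\<in>UNIV. \<Sum>a\<in>UNIV. C k k a * C a i j) = real CARD('n) * (2 * \<alpha> i * \<alpha> j - \<kappa> * d)"
    by (subst sum.swap) (simp only: sum_distrib_right[symmetric] C_contractions mult.assoc sum_distrib_left[symmetric] d_def)
  ultimately have "ricci gbar i j x = - (q - P\<^sup>2) * ((2 - real CARD('n)) * \<alpha> i * \<alpha> j - \<kappa> * d)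
     + P\<^sup>2 * (real CARD('n) * (2 * \<alpha> i * \<alpha> j - \<kappa> * d)
        - ((real CARD('n) + 2) * \<alpha> i * \<alpha> j - 2 * \<kappa> * d))"
    unfolding C_contractions d_def[symmetric] by algebra
  also have "\<dots> = (real CARD('n) - 2) * q * \<alpha> i * \<alpha> j + \<kappa> * (q - (real CARD('n) - 1) * P\<^sup>2) * d"
    by algebra
  finally show ?thesis unfolding P_def q_def d_def .
qed

lemma scalar_curvature_gbar:
  "scalar_curvature gbar x = \<kappa> * (2 * (real CARD('n) - 1) * \<phi> (lin_form \<alpha> x) * deriv (deriv \<phi>) (lin_form \<alpha> x)
     - real CARD('n) * (real CARD('n) - 1) * (deriv \<phi> (lin_form \<alpha> x))\<^sup>2)"
proof -
  let ?\<xi> = "lin_form \<alpha> x"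
  define A where "A = (real CARD('n) - 2) * (deriv (deriv \<phi>) ?\<xi> / \<phi> ?\<xi>)"
  define B where "B = \<kappa> * (deriv (deriv \<phi>) ?\<xi> / \<phi> ?\<xi> - (real CARD('n) - 1) * (p ?\<xi>)\<^sup>2)"
  have R: "ricci gbar i i x = A * (\<alpha> i)\<^sup>2 + B * \<epsilon> i" for i
    by (simp add: ricci_gbar A_def B_def power2_eq_square)
  have "scalar_curvature gbar x = (\<Sum>i\<in>UNIV. (\<phi> ?\<xi>)\<^sup>2 * \<epsilon> i * ricci gbar i i x)"
    unfolding scalar_curvature_def inv_gbar mult.assoc sum_distrib_left[symmetric] by (simp add: sum_delta_mult)
  also have "\<dots> = (\<Sum>i\<in>UNIV. (\<phi> ?\<xi>)\<^sup>2 * A * (\<epsilon> i * (\<alpha> i)\<^sup>2) + (\<phi> ?\<xi>)\<^sup>2 * B)"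
  proof (rule sum.cong)
    show "(\<phi> ?\<xi>)\<^sup>2 * \<epsilon> i * ricci gbar i i x = (\<phi> ?\<xi>)\<^sup>2 * A * (\<epsilon> i * (\<alpha> i)\<^sup>2) + (\<phi> ?\<xi>)\<^sup>2 * B" for i
      unfolding R using sign_square[of i] by algebra
  qed simp
  also have "\<dots> = (\<phi> ?\<xi>)\<^sup>2 * (\<kappa> * A + real CARD('n) * B)"
    by (simp add: sum.distrib sum_distrib_left[symmetric] \<kappa>) (simp add: algebra_simps)
  also have "\<dots> = \<kappa> * (2 * (real CARD('n) - 1) * \<phi> ?\<xi> * deriv (deriv \<phi>) ?\<xi>
     - real CARD('n) * (real CARD('n) - 1) * (deriv \<phi> ?\<xi>)\<^sup>2)"
    unfolding A_def B_def p_def using \<phi>_nz[of ?\<xi>] by (simp add: field_simps power2_eq_square)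
  finally show ?thesis .
qed

context
  fixes f :: "real \<Rightarrow> real"
  assumes f_smooth: "smooth_on UNIV f"
begin

lemma DERIV_f: "(f has_real_derivative deriv f \<xi>) (at \<xi>)"
  "(deriv f has_real_derivative deriv (deriv f) \<xi>) (at \<xi>)"
  by (rule smooth_on_DERIV[OF f_smooth UNIV_I] smooth_on_DERIV[OF smooth_on_deriv[OF f_smooth] UNIV_I])+

lemma partial_deriv_f: "partial_deriv i (\<lambda>x. f (lin_form \<alpha> x)) = (\<lambda>x. deriv f (lin_form \<alpha> x) * \<alpha> i)"
  by (rule ext) (simp add: partial_deriv_lin_form[OF DERIV_differentiable[OF DERIV_f(1)]])

lemma hessian_gbar:
  "hessian gbar (\<lambda>x. f (lin_form \<alpha> x)) i j x
    = (deriv (deriv f) (lin_form \<alpha> x) + 2 * p (lin_form \<alpha> x) * deriv f (lin_form \<alpha> x)) * \<alpha> i * \<alpha> j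
      - \<kappa> * p (lin_form \<alpha> x) * deriv f (lin_form \<alpha> x) * (if i = j then \<epsilon> i else 0)"
proof -
  let ?\<xi> = "lin_form \<alpha> x"
  have D: "((\<lambda>\<xi>. deriv f \<xi> * \<alpha> i) has_real_derivative deriv (deriv f) \<xi> * \<alpha> i) (at \<xi>)" for \<xi>
    by (rule derivative_eq_intros DERIV_f refl | simp)+
  have "partial_deriv j (partial_deriv i (\<lambda>x. f (lin_form \<alpha> x))) x = deriv (deriv f) ?\<xi> * \<alpha> i * \<alpha> j"
    unfolding partial_deriv_f
    by (simp add: partial_deriv_lin_form[OF DERIV_differentiable[OF D]] DERIV_imp_deriv[OF D])
  moreover have "(\<Sum>l\<in>UNIV. christoffel gbar l i j x * partial_deriv l (\<lambda>x. f (lin_form \<alpha> x)) x)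
      = - p ?\<xi> * deriv f ?\<xi> * (\<Sum>l\<in>UNIV. \<alpha> l * C l i j)"
    by (simp add: christoffel_gbar partial_deriv_f sum_distrib_left algebra_simps)
  ultimately show ?thesis
    unfolding hessian_def C_contractions by algebra
qed

lemma gradient_gbar:
  "gradient gbar (\<lambda>x. f (lin_form \<alpha> x)) k = (\<lambda>x. (\<phi> (lin_form \<alpha> x))\<^sup>2 * deriv f (lin_form \<alpha> x) * (\<epsilon> k * \<alpha> k))"
  by (auto simp: gradient_def fun_eq_iff inv_gbar partial_deriv_f mult.assoc sum_distrib_left[symmetric] sum_delta_mult)

lemma grad_norm_sq_gbar:
  "grad_norm_sq gbar (\<lambda>x. f (lin_form \<alpha> x)) x = \<kappa> * (\<phi> (lin_form \<alpha> x))\<^sup>2 * (deriv f (lin_form \<alpha> x))\<^sup>2"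
  unfolding grad_norm_sq_def gradient_gbar partial_deriv_f \<kappa>[symmetric] sum_distrib_right
  by (rule sum.cong) (auto simp: power2_eq_square)

lemma DERIV_gradient_coefficient:
  "((\<lambda>\<xi>. (\<phi> \<xi>)\<^sup>2 * deriv f \<xi> * c) has_real_derivative
      (2 * \<phi> \<xi> * deriv \<phi> \<xi> * deriv f \<xi> + (\<phi> \<xi>)\<^sup>2 * deriv (deriv f) \<xi>) * c) (at \<xi>)"
  by (rule derivative_eq_intros DERIV_\<phi> DERIV_f refl | simp add: algebra_simps)+

lemma laplacian_gbar:
  "laplacian gbar (\<lambda>x. f (lin_form \<alpha> x)) x
    = \<kappa> * ((\<phi> (lin_form \<alpha> x))\<^sup>2 * deriv (deriv f) (lin_form \<alpha> x)
       - (real CARD('n) - 2) * \<phi> (lin_form \<alpha> x) * deriv \<phi> (lin_form \<alpha> x) * deriv f (lin_form \<alpha> x))"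
proof -
  let ?\<xi> = "lin_form \<alpha> x"
  define A where "A = 2 * \<phi> ?\<xi> * deriv \<phi> ?\<xi> * deriv f ?\<xi> + (\<phi> ?\<xi>)\<^sup>2 * deriv (deriv f) ?\<xi>"
  define B where "B = p ?\<xi> * (\<phi> ?\<xi>)\<^sup>2 * deriv f ?\<xi>"
  have "partial_deriv k (gradient gbar (\<lambda>x. f (lin_form \<alpha> x)) k) x = A * (\<epsilon> k * (\<alpha> k)\<^sup>2)" for k
    unfolding gradient_gbar A_def
    by (simp add: partial_deriv_lin_form[OF DERIV_differentiable[OF DERIV_gradient_coefficient]]
        DERIV_imp_deriv[OF DERIV_gradient_coefficient]) (simp add: power2_eq_square)
  moreover have "(\<Sum>k\<in>UNIV. \<Sum>l\<in>UNIV. christoffel gbar k k l x * gradient gbar (\<lambda>x. f (lin_form \<alpha> x)) l x)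
      = - B * real CARD('n) * \<kappa>"
  proof -
    have "(\<Sum>k\<in>UNIV. \<Sum>l\<in>UNIV. christoffel gbar k k l x * gradient gbar (\<lambda>x. f (lin_form \<alpha> x)) l x)
      = - B * (\<Sum>k\<in>UNIV. \<Sum>l\<in>UNIV. C k k l * (\<epsilon> l * \<alpha> l))"
      by (simp add: christoffel_gbar gradient_gbar B_def sum_distrib_left sum_negf algebra_simps)
    also have "(\<Sum>k\<in>UNIV. \<Sum>l\<in>UNIV. C k k l * (\<epsilon> l * \<alpha> l)) = real CARD('n) * \<kappa>"
      unfolding \<kappa>[symmetric]
      by (subst sum.swap) (simp only: sum_distrib_right[symmetric] C_contractions,
          simp add: sum_distrib_left power2_eq_square algebra_simps)
    finally show ?thesis by simp
  qed
  ultimately have "laplacian gbar (\<lambda>x. f (lin_form \<alpha> x)) x = A * \<kappa> - B * real CARD('n) * \<kappa>"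
    unfolding laplacian_def by (simp add: sum.distrib sum_distrib_left[symmetric] \<kappa>)
  also have "B = \<phi> ?\<xi> * deriv \<phi> ?\<xi> * deriv f ?\<xi>"
    using \<phi>_nz[of ?\<xi>] by (simp add: B_def p_def power2_eq_square)
  finally show ?thesis unfolding A_def by algebra
qed

end

end

section \<open>The Einstein condition as a system of ordinary differential equations\<close>

context conformal_line
begin

lemma semi_riemannian_gbar: "semi_riemannian_manifold (coordinate_space gbar)"
proof (rule semi_riemannian_coordinate_space[where s=\<epsilon>])
  have "smooth_on UNIV (\<lambda>\<xi>. 1 / (\<phi> \<xi>)\<^sup>2 * c)" for c
    unfolding power2_eq_square
    by (intro smooth_on_mult smooth_on_divide smooth_on_const open_UNIV \<phi>_smooth) (simp add: \<phi>_nz)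
  from smooth_on_compose_lin_form[OF this]
  show "smooth_on UNIV (\<lambda>x. gbar x $ i $ j)" for i j unfolding gbar_nth .
  show "has_signature (gbar x) \<epsilon>" for x
    unfolding has_signature_def
  proof (intro exI conjI)
(* Scaling the coordinate frame by \<phi> makes it orthonormal for the conformal metric. *)
    show "invertible (\<phi> (lin_form \<alpha> x) *\<^sub>R (mat 1 :: real^'n^'n))"
      by (rule scalar_invertible) (use \<phi>_nz in \<open>auto simp: invertible_def intro: exI[of _ "mat 1"]\<close>)
    show "transpose (\<phi> (lin_form \<alpha> x) *\<^sub>R mat 1) ** gbar x ** (\<phi> (lin_form \<alpha> x) *\<^sub>R mat 1)
        = (\<chi> i j. if i = j then \<epsilon> i else 0)"
      using \<phi>_nz[of "lin_form \<alpha> x"]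
      by (simp add: transpose_scalar transpose_mat matrix_scalar_ac scalar_matrix_assoc[symmetric]
          conformal_metric_def pseudo_euclidean_def power2_eq_square)
  qed
qed (use signs transpose_gbar invertible_gbar in auto)

text \<open>A second index is indispensable: in dimension one both terms are multiples of the same matrix.
  With \<open>\<alpha>\<^sub>i \<noteq> 0\<close> and \<open>j \<noteq> i\<close>, the entry \<open>(i, j)\<close> gives \<open>A \<alpha>\<^sub>j = 0\<close>, then \<open>(j, j)\<close> gives \<open>B = 0\<close>, then \<open>(i, i)\<close>
  gives \<open>A = 0\<close>.\<close>
lemma coefficients_vanish:
  assumes "CARD('n) \<ge> 2" "\<kappa> \<noteq> 0"
  shows "(\<forall>i j. A * \<alpha> i * \<alpha> j + B * (if i = j then \<epsilon> i else 0) = 0) \<longleftrightarrow> A = 0 \<and> B = 0"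
proof
  assume *: "\<forall>i j. A * \<alpha> i * \<alpha> j + B * (if i = j then \<epsilon> i else 0) = 0"
  obtain i where i: "\<alpha> i \<noteq> 0" using \<kappa> assms(2) by force
  obtain j where j: "j \<noteq> i"
  proof -
    have "UNIV \<noteq> {i}"
    proof
      assume "UNIV = {i}"
      then have "CARD('n) = card {i}" by (rule arg_cong)
      then show False using assms(1) by simp
    qed
    then show thesis using that by blast
  qed
  have "A * \<alpha> j = 0" using *[rule_format, of i j] i j by simp
  then have "B = 0" using *[rule_format, of j j] sign_square[of j] by auto
  then show "A = 0 \<and> B = 0" using *[rule_format, of i i] i by simp
qed simp

text \<open>The preimage lies on the line spanned by the \<open>\<epsilon>\<close>-dual of \<open>\<alpha>\<close>, on which \<open>\<xi>\<close> grows with slope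
  \<open>\<kappa> \<noteq> 0\<close>. Hence an identity at all points is an identity for all \<open>\<xi>\<close>.\<close>
lemma lin_form_surj:
  assumes "\<kappa> \<noteq> 0" obtains x where "lin_form \<alpha> x = \<xi>"
proof
  have "lin_form \<alpha> (\<chi> k. \<xi> / \<kappa> * (\<epsilon> k * \<alpha> k)) = (\<Sum>k\<in>UNIV. \<xi> / \<kappa> * (\<epsilon> k * (\<alpha> k)\<^sup>2))"
    unfolding lin_form_def by (rule sum.cong) (auto simp: power2_eq_square)
  then show "lin_form \<alpha> (\<chi> k. \<xi> / \<kappa> * (\<epsilon> k * \<alpha> k)) = \<xi>"
    using assms by (simp only: sum_distrib_left[symmetric] \<kappa>) simp
qed

text \<open>The three equations are the two coefficients of the base block and the scalar factor of the
  fibre block.\<close>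
lemma einstein_warped_product_iff:
  fixes N :: "('p::{t2_space,second_countable_topology}, 'c, 'm::finite) metric_atlas"
  assumes n: "CARD('n) \<ge> 2" and \<kappa>0: "\<kappa> \<noteq> 0"
    and N: "semi_riemannian_manifold N" "ricci_flat N"
    and f: "smooth_on UNIV f" "\<And>\<xi>. f \<xi> \<noteq> 0"
  shows "einstein_manifold (warped_product (coordinate_space gbar) (\<lambda>x. f (lin_form \<alpha> x)) N) lam \<longleftrightarrow>
    (\<forall>\<xi>. (real CARD('n) - 2) * (deriv (deriv \<phi>) \<xi> / \<phi> \<xi>)
            - real CARD('m) / f \<xi> * (deriv (deriv f) \<xi> + 2 * p \<xi> * deriv f \<xi>) = 0 \<and>
         \<kappa> * (deriv (deriv \<phi>) \<xi> / \<phi> \<xi> - (real CARD('n) - 1) * (p \<xi>)\<^sup>2)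
            + real CARD('m) / f \<xi> * (\<kappa> * p \<xi> * deriv f \<xi>) - lam / (\<phi> \<xi>)\<^sup>2 = 0 \<and>
         f \<xi> * (\<kappa> * ((\<phi> \<xi>)\<^sup>2 * deriv (deriv f) \<xi>
             - (real CARD('n) - 2) * \<phi> \<xi> * deriv \<phi> \<xi> * deriv f \<xi>))
           + (real CARD('m) - 1) * (\<kappa> * (\<phi> \<xi>)\<^sup>2 * (deriv f \<xi>)\<^sup>2) + lam * (f \<xi>)\<^sup>2 = 0)"
    (is "?lhs \<longleftrightarrow> (\<forall>\<xi>. ?A \<xi> = 0 \<and> ?B \<xi> = 0 \<and> ?K \<xi> + lam * (f \<xi>)\<^sup>2 = 0)")
proof -
  let ?F = "\<lambda>x. f (lin_form \<alpha> x)"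
  interpret X: warped_over_coordinates gbar ?F N
    by unfold_locales (use semi_riemannian_gbar N f smooth_on_compose_lin_form[OF f(1)] in auto)
  have chart: "warped_chart gbar ?F (metric N d) (image_of N d)" if d: "d \<in> charts N" for d
  proof
    show "partial_deriv i ?F differentiable (at x)" for i x
      unfolding partial_deriv_f[OF f(1)]
      by (intro differentiable_mult differentiable_const
          differentiable_lin_form[OF DERIV_differentiable[OF DERIV_f(2)[OF f(1)]]])
    show "gradient gbar ?F k differentiable (at x)" for k x
      unfolding gradient_gbar[OF f(1)]
      by (rule differentiable_lin_form[OF DERIV_differentiable[OF DERIV_gradient_coefficient[OF f(1)]]])
    show "?F differentiable (at x)" for x
      by (rule differentiable_lin_form[OF DERIV_differentiable[OF DERIV_f(1)[OF f(1)]]])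
  qed (use f X.chart_N[OF d] X.metric_N[OF d] smooth_on_differentiable[OF X.metric_N(1)[OF d]]
        transpose_gbar invertible_gbar in auto)
  have base: "ricci gbar i j x - real CARD('m) / ?F x * hessian gbar ?F i j x = lam * gbar x $ i $ j
      \<longleftrightarrow> ?A (lin_form \<alpha> x) * \<alpha> i * \<alpha> j + ?B (lin_form \<alpha> x) * (if i = j then \<epsilon> i else 0) = 0" for i j x
    unfolding ricci_gbar hessian_gbar[OF f(1)] gbar_nth by (simp add: algebra_simps)
  have fibre: "?F x * laplacian gbar ?F x + (real CARD('m) - 1) * grad_norm_sq gbar ?F x
      = ?K (lin_form \<alpha> x)" for x
    unfolding laplacian_gbar[OF f(1)] grad_norm_sq_gbar[OF f(1)] ..
  have local: "(\<forall>I J. ricci (metric X.X (c, d)) I J y = lam * metric X.X (c, d) y $ I $ J)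
      \<longleftrightarrow> ?A \<xi> = 0 \<and> ?B \<xi> = 0 \<and> ?K \<xi> + lam * (f \<xi>)\<^sup>2 = 0"
    if d: "d \<in> charts N" and y: "right_part y \<in> image_of N d" and \<xi>: "\<xi> = lin_form \<alpha> (left_part y)" for c d y \<xi>
  proof -
    interpret warped_chart gbar ?F "metric N d" "image_of N d" by (rule chart[OF d])
    have flat: "ricci (metric N d) a b (right_part y) = 0" for a b
      using N(2) d y by (simp add: ricci_flat_def)
    obtain a b where ab: "metric N d (right_part y) $ a $ b \<noteq> 0"
      using exists_nonzero_entry[OF g_inv[OF y]] .
    have "(\<forall>I J. ricci W I J y = lam * W y $ I $ J) \<longleftrightarrow>
        (\<forall>i j. ricci W (Inl i) (Inl j) y = lam * W y $ Inl i $ Inl j) \<and>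
        (\<forall>i b. ricci W (Inl i) (Inr b) y = lam * W y $ Inl i $ Inr b) \<and>
        (\<forall>a j. ricci W (Inr a) (Inl j) y = lam * W y $ Inr a $ Inl j) \<and>
        (\<forall>a b. ricci W (Inr a) (Inr b) y = lam * W y $ Inr a $ Inr b)"
      by (metis sum.exhaust)
    also have "\<dots> \<longleftrightarrow> (\<forall>i j. ?A \<xi> * \<alpha> i * \<alpha> j + ?B \<xi> * (if i = j then \<epsilon> i else 0) = 0) \<and>
        (\<forall>a b. (?K \<xi> + lam * (f \<xi>)\<^sup>2) * metric N d (right_part y) $ a $ b = 0)"
    proof -
      have aux: "0 - K * g = l * (u * g) \<longleftrightarrow> (K + l * u) * g = 0" for K g l u :: real
        by (auto simp: algebra_simps)
      have "ricci W (Inl i) (Inl j) y = lam * W y $ Inl i $ Inl j \<longleftrightarrow>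
          ?A \<xi> * \<alpha> i * \<alpha> j + ?B \<xi> * (if i = j then \<epsilon> i else 0) = 0" for i j
        unfolding ricci_W[OF y] W_nth \<xi> by (rule base)
      moreover have "ricci W (Inl i) (Inr b) y = lam * W y $ Inl i $ Inr b"
        "ricci W (Inr b) (Inl i) y = lam * W y $ Inr b $ Inl i" for i b
        by (simp_all only: ricci_W[OF y] W_nth mult_zero_right)
      moreover have "ricci W (Inr a) (Inr b) y = lam * W y $ Inr a $ Inr b \<longleftrightarrow>
        (?K \<xi> + lam * (f \<xi>)\<^sup>2) * metric N d (right_part y) $ a $ b = 0" for a b
        unfolding ricci_W[OF y] W_nth flat fibre[of "left_part y", folded \<xi>] \<xi>[symmetric] aux ..
      ultimately show ?thesis by (simp only: simp_thms)
    qed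
    also have "\<dots> \<longleftrightarrow> ?A \<xi> = 0 \<and> ?B \<xi> = 0 \<and> ?K \<xi> + lam * (f \<xi>)\<^sup>2 = 0"
      unfolding coefficients_vanish[OF n \<kappa>0] using ab by auto
    finally show ?thesis by (simp add: X.X_simps)
  qed
  have "(\<Union>d\<in>charts N. dom_of N d) = UNIV"
    using N(1) by (simp add: semi_riemannian_manifold_def smooth_manifold_def)
  then obtain d and q :: 'p where d: "d \<in> charts N" and q: "q \<in> dom_of N d" by blast
  have z: "coord N d q \<in> image_of N d" using q by (simp add: image_of_def)
  show ?thesis
  proof
    assume L: ?lhs
    show "\<forall>\<xi>. ?A \<xi> = 0 \<and> ?B \<xi> = 0 \<and> ?K \<xi> + lam * (f \<xi>)\<^sup>2 = 0"
    proof
      fix \<xi>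
      obtain x where x: "lin_form \<alpha> x = \<xi>" using lin_form_surj[OF \<kappa>0] .
      let ?y = "join_parts x (coord N d q)"
      have "((), d) \<in> charts X.X" "?y \<in> image_of X.X ((), d)"
        using d z by (simp_all add: X.X_simps X.image_of_X)
      then have "\<forall>I J. ricci (metric X.X ((), d)) I J ?y = lam * metric X.X ((), d) ?y $ I $ J"
        using L unfolding einstein_manifold_def by blast
      then show "?A \<xi> = 0 \<and> ?B \<xi> = 0 \<and> ?K \<xi> + lam * (f \<xi>)\<^sup>2 = 0"
        by (subst (asm) local[OF d]) (use z x in auto)
    qed
  next
    assume R: "\<forall>\<xi>. ?A \<xi> = 0 \<and> ?B \<xi> = 0 \<and> ?K \<xi> + lam * (f \<xi>)\<^sup>2 = 0"
    show ?lhs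
      unfolding einstein_manifold_def
    proof (intro conjI ballI X.semi_riemannian_X)
      fix e y assume "e \<in> charts X.X" "y \<in> image_of X.X e"
      then obtain c d where e: "e = (c, d)" and d: "d \<in> charts N" and y: "right_part y \<in> image_of N d"
        by (auto simp: X.X_simps X.image_of_X)
      show "\<forall>I J. ricci (metric X.X e) I J y = lam * metric X.X e y $ I $ J"
        unfolding e local[OF d y refl] using R by blast
    qed
  qed
qed

end

text \<open>The letters stand for the values at one point: \<open>a, b, c\<close> for \<open>\<phi>, \<phi>', \<phi>''\<close>, \<open>u, v, w\<close> for \<open>f, f', f''\<close>, and
  \<open>D\<close> for \<open>(G\<phi>)'\<close>. Up to nonzero factors built from \<open>a\<close>, \<open>u\<close> and \<open>\<kappa>\<close>, the two systems agree equation by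
  equation; since \<open>\<kappa>\<^sup>2 = 1\<close>, multiplying by \<open>\<kappa>\<close> moves it in front of \<open>\<lambda>\<close>.\<close>
lemma einstein_equations_algebra:
  fixes a b c u v w n m \<kappa> lam G D :: real
  assumes a: "a \<noteq> 0" and u: "u \<noteq> 0" and \<kappa>: "\<kappa> * \<kappa> = 1"
    and G: "G = a * v / u" and D: "D = 2 * a * b * v / u + a\<^sup>2 * w / u - a\<^sup>2 * v\<^sup>2 / u\<^sup>2"
  shows "(n - 2) * (c / a) - m / u * (w + 2 * (b / a) * v) = 0
      \<longleftrightarrow> (n - 2) * a * c - m * D = m * G\<^sup>2"
    "\<kappa> * (c / a - (n - 1) * (b / a)\<^sup>2) + m / u * (\<kappa> * (b / a) * v) - lam / a\<^sup>2 = 0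
      \<longleftrightarrow> a * c - (n - 1) * b\<^sup>2 + m * G * b = \<kappa> * lam"
    "u * (\<kappa> * (a\<^sup>2 * w - (n - 2) * a * b * v)) + (m - 1) * (\<kappa> * a\<^sup>2 * v\<^sup>2) + lam * u\<^sup>2 = 0
      \<longleftrightarrow> n * G * b - D - m * G\<^sup>2 = \<kappa> * lam"
proof -
  have k0: "\<kappa> \<noteq> 0" using \<kappa> by auto
  have "a\<^sup>2 * ((n - 2) * (c / a) - m / u * (w + 2 * (b / a) * v)) = (n - 2) * a * c - m * D - m * G\<^sup>2"
    unfolding G D using a u by (simp add: field_simps power2_eq_square)
  then show "(n - 2) * (c / a) - m / u * (w + 2 * (b / a) * v) = 0
      \<longleftrightarrow> (n - 2) * a * c - m * D = m * G\<^sup>2"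
    using a by (metis (no_types, lifting) eq_iff_diff_eq_0 mult_eq_0_iff power_not_zero)
  have "a\<^sup>2 * (\<kappa> * (c / a - (n - 1) * (b / a)\<^sup>2) + m / u * (\<kappa> * (b / a) * v) - lam / a\<^sup>2)
      = \<kappa> * (a * c - (n - 1) * b\<^sup>2 + m * G * b) - lam"
    unfolding G using a u by (simp add: field_simps power2_eq_square)
  also have "\<dots> = \<kappa> * (a * c - (n - 1) * b\<^sup>2 + m * G * b - \<kappa> * lam)" using \<kappa> by algebra
  finally show "\<kappa> * (c / a - (n - 1) * (b / a)\<^sup>2) + m / u * (\<kappa> * (b / a) * v) - lam / a\<^sup>2 = 0
      \<longleftrightarrow> a * c - (n - 1) * b\<^sup>2 + m * G * b = \<kappa> * lam"
    using a k0 by (metis (no_types, lifting) eq_iff_diff_eq_0 mult_eq_0_iff power_not_zero)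
  have "- (u\<^sup>2 * (n * G * b - D - m * G\<^sup>2)) = u * (a\<^sup>2 * w - (n - 2) * a * b * v) + (m - 1) * a\<^sup>2 * v\<^sup>2"
    unfolding G D using a u by (simp add: field_simps power2_eq_square)
  then have "u * (\<kappa> * (a\<^sup>2 * w - (n - 2) * a * b * v)) + (m - 1) * (\<kappa> * a\<^sup>2 * v\<^sup>2) + lam * u\<^sup>2
      = - (\<kappa> * u\<^sup>2) * (n * G * b - D - m * G\<^sup>2 - \<kappa> * lam)"
    using \<kappa> by algebra
  then show "u * (\<kappa> * (a\<^sup>2 * w - (n - 2) * a * b * v)) + (m - 1) * (\<kappa> * a\<^sup>2 * v\<^sup>2) + lam * u\<^sup>2 = 0
      \<longleftrightarrow> n * G * b - D - m * G\<^sup>2 = \<kappa> * lam"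
    using u k0 by simp
qed

text \<open>The difference of \<open>n\<close> times the second equation and \<open>m\<close> times the third, in which the first one
  is used to eliminate \<open>D\<close>. The left-hand side is the radicand in the formula for \<open>G\<close>.\<close>
lemma scalar_curvature_of_solution:
  fixes a b c n m \<kappa> lam G D R :: real
  assumes "\<kappa> * \<kappa> = 1" and m: "m > 1"
    and "(n - 2) * a * c - m * D = m * G\<^sup>2"
    and "a * c - (n - 1) * b\<^sup>2 + m * G * b = \<kappa> * lam"
    and "n * G * b - D - m * G\<^sup>2 = \<kappa> * lam"
    and "R = \<kappa> * (2 * (n - 1) * a * c - n * (n - 1) * b\<^sup>2)"
  shows "\<kappa> * (lam * (n - m) - R) / (m * (m - 1)) = G\<^sup>2"
proof -
  have "\<kappa> * (lam * (n - m) - R) = G\<^sup>2 * (m * (m - 1))" using assms by algebra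
  then show ?thesis using m by simp
qed

theorem theorem4:
  fixes N :: "('p::{t2_space,second_countable_topology}, 'c, 'm::finite) metric_atlas"
    and \<epsilon> \<alpha> :: "'n::finite \<Rightarrow> real"
    and \<phi> f :: "real \<Rightarrow> real"
    and \<kappa> lam :: real
    and gbar :: "real^'n \<Rightarrow> real^'n^'n"
  assumes "CARD('n) \<ge> 3" and "CARD('m) \<ge> 2"
    and "semi_riemannian_manifold N" and "ricci_flat N"
    and "\<forall>i. \<epsilon> i = 1 \<or> \<epsilon> i = -1" and "\<exists>i. \<epsilon> i = 1"
    and "smooth_on UNIV \<phi>" and "smooth_on UNIV f"
    and "\<forall>\<xi>. \<phi> \<xi> \<noteq> 0" and "\<forall>\<xi>. f \<xi> > 0"
    and "(\<Sum>k\<in>UNIV. \<epsilon> k * (\<alpha> k)\<^sup>2) = \<kappa>" and "\<kappa> = 1 \<or> \<kappa> = -1"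
    and "gbar = conformal_metric \<epsilon> (\<lambda>x. \<phi> (lin_form \<alpha> x))"
  shows "einstein_manifold
           (warped_product (coordinate_space gbar) (\<lambda>x. f (lin_form \<alpha> x)) N) lam
         \<longleftrightarrow>
         (\<exists>G. smooth_on UNIV G \<and>
            (\<forall>x. let r = \<kappa> * (lam * (real CARD('n) - real CARD('m)) - scalar_curvature gbar x)
                           / (real CARD('m) * (real CARD('m) - 1))
                 in r \<ge> 0 \<and> (G (lin_form \<alpha> x) = sqrt r \<or> G (lin_form \<alpha> x) = - sqrt r)) \<and>
            (\<forall>\<xi>. (real CARD('n) - 2) * \<phi> \<xi> * deriv (deriv \<phi>) \<xi>
                    - real CARD('m) * deriv (\<lambda>t. G t * \<phi> t) \<xi>
                  = real CARD('m) * (G \<xi>)\<^sup>2) \<and>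
            (\<forall>\<xi>. \<phi> \<xi> * deriv (deriv \<phi>) \<xi> - (real CARD('n) - 1) * (deriv \<phi> \<xi>)\<^sup>2
                    + real CARD('m) * G \<xi> * deriv \<phi> \<xi>
                  = \<kappa> * lam) \<and>
            (\<forall>\<xi>. real CARD('n) * G \<xi> * deriv \<phi> \<xi> - deriv (\<lambda>t. G t * \<phi> t) \<xi>
                    - real CARD('m) * (G \<xi>)\<^sup>2
                  = \<kappa> * lam) \<and>
            (\<exists>\<Theta>>0. \<exists>P. (\<forall>\<xi>. (P has_real_derivative G \<xi> / \<phi> \<xi>) (at \<xi>)) \<and>
               (\<forall>\<xi>. f \<xi> = \<Theta> * exp (P \<xi>))))"
    (is "?einstein \<longleftrightarrow> (\<exists>G. smooth_on UNIV G \<and> (\<forall>x. ?root G x) \<and> (\<forall>\<xi>. ?ode1 G \<xi>) \<and>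
        (\<forall>\<xi>. ?ode2 G \<xi>) \<and> (\<forall>\<xi>. ?ode3 G \<xi>) \<and> ?warp G)")
proof -
  interpret conformal_line \<epsilon> \<alpha> \<phi> \<kappa>
    by unfold_locales (use assms in auto)
  have gbar: "gbar = conformal_metric \<epsilon> (\<lambda>x. \<phi> (lin_form \<alpha> x))" by fact
  have f_nz: "f \<xi> \<noteq> 0" for \<xi> using assms(10) by (metis less_irrefl)
  have \<kappa>2: "\<kappa> * \<kappa> = 1" and \<kappa>0: "\<kappa> \<noteq> 0" using assms(12) by auto
  have n: "CARD('n) \<ge> 2" and m: "real CARD('m) > 1" using assms(1,2) by simp_all
  define G\<^sub>f where "G\<^sub>f = (\<lambda>\<xi>. \<phi> \<xi> * deriv f \<xi> / f \<xi>)"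
  have DG: "deriv (\<lambda>t. G\<^sub>f t * \<phi> t) \<xi> = 2 * \<phi> \<xi> * deriv \<phi> \<xi> * deriv f \<xi> / f \<xi>
      + (\<phi> \<xi>)\<^sup>2 * deriv (deriv f) \<xi> / f \<xi> - (\<phi> \<xi>)\<^sup>2 * (deriv f \<xi>)\<^sup>2 / (f \<xi>)\<^sup>2" for \<xi>
    unfolding G\<^sub>f_def
    by (rule DERIV_imp_deriv)
      (rule derivative_eq_intros DERIV_\<phi> DERIV_f[OF assms(8)] f_nz refl |
        simp add: f_nz field_simps power2_eq_square)+
  have einstein_iff: "?einstein \<longleftrightarrow> (\<forall>\<xi>. ?ode1 G\<^sub>f \<xi> \<and> ?ode2 G\<^sub>f \<xi> \<and> ?ode3 G\<^sub>f \<xi>)"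
    unfolding gbar einstein_warped_product_iff[OF n \<kappa>0 assms(3,4,8) f_nz] p_def
      einstein_equations_algebra[OF \<phi>_nz f_nz \<kappa>2 fun_cong[OF G\<^sub>f_def] DG] ..
  show ?thesis
  proof
    assume ?einstein
    then have ode: "?ode1 G\<^sub>f \<xi>" "?ode2 G\<^sub>f \<xi>" "?ode3 G\<^sub>f \<xi>" for \<xi>
      using einstein_iff by blast+
    have "?root G\<^sub>f x" for x
      using scalar_curvature_of_solution[OF \<kappa>2 m ode scalar_curvature_gbar[of x]] unfolding gbar
      by (auto simp: Let_def abs_if)
    moreover have "smooth_on UNIV G\<^sub>f"
      unfolding G\<^sub>f_def
      by (intro smooth_on_divide smooth_on_mult smooth_on_deriv open_UNIV assms f_nz)
    moreover have "?warp G\<^sub>f"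
    proof (intro exI[of _ 1] exI[of _ "\<lambda>\<xi>. ln (f \<xi>)"] conjI allI)
      show "((\<lambda>\<xi>. ln (f \<xi>)) has_real_derivative G\<^sub>f \<xi> / \<phi> \<xi>) (at \<xi>)" for \<xi>
        unfolding G\<^sub>f_def using assms(10) \<phi>_nz[of \<xi>]
        by (auto intro!: derivative_eq_intros DERIV_f[OF assms(8)] simp: divide_simps)
    qed (use assms(10) in auto)
    ultimately show "\<exists>G. smooth_on UNIV G \<and> (\<forall>x. ?root G x) \<and> (\<forall>\<xi>. ?ode1 G \<xi>) \<and>
        (\<forall>\<xi>. ?ode2 G \<xi>) \<and> (\<forall>\<xi>. ?ode3 G \<xi>) \<and> ?warp G" using ode by blast
  next
    assume "\<exists>G. smooth_on UNIV G \<and> (\<forall>x. ?root G x) \<and> (\<forall>\<xi>. ?ode1 G \<xi>) \<and>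
        (\<forall>\<xi>. ?ode2 G \<xi>) \<and> (\<forall>\<xi>. ?ode3 G \<xi>) \<and> ?warp G"
    then obtain G \<Theta> P where ode: "\<forall>\<xi>. ?ode1 G \<xi>" "\<forall>\<xi>. ?ode2 G \<xi>" "\<forall>\<xi>. ?ode3 G \<xi>"
      and P: "\<And>\<xi>. (P has_real_derivative G \<xi> / \<phi> \<xi>) (at \<xi>)" and f: "\<And>\<xi>. f \<xi> = \<Theta> * exp (P \<xi>)"
      by blast
  (* Differentiating f = \<Theta> exp P recovers the only G that f admits. *)
    have "G \<xi> = G\<^sub>f \<xi>" for \<xi>
    proof -
      have "((\<lambda>\<xi>. \<Theta> * exp (P \<xi>)) has_real_derivative \<Theta> * exp (P \<xi>) * (G \<xi> / \<phi> \<xi>)) (at \<xi>)"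
        by (auto intro!: derivative_eq_intros P)
      then have "deriv f \<xi> = f \<xi> * (G \<xi> / \<phi> \<xi>)"
        using f by (metis (no_types, lifting) DERIV_imp_deriv ext)
      then show ?thesis using \<phi>_nz[of \<xi>] f_nz[of \<xi>] by (simp add: G\<^sub>f_def)
    qed
    then have "G = G\<^sub>f" by auto
    with ode show ?einstein unfolding einstein_iff by blast
  qed
qed

end
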